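(* Let $p>2$ and suppose that (H1) and (H4), as stated in the context, hold. Then there exist $\varepsilon>0$, a neighbourhood $U$ of $(\lambda_0,0)$ in $\mathbb{R}\times Z$ and a continuous mapping $s\mapsto(\lambda(s),z(s)):(-\varepsilon,\varepsilon)\to U$ such that $(\lambda(0),z(0))=(\lambda_0,0)$ and $$\{(s,\lambda,z)\in(-\varepsilon,\varepsilon)\times U:G(s,\lambda,z)=0\}=\{(s,\lambda(s),z(s)):s\in(-\varepsilon,\varepsilon)\}.$$
   Context: $N\ge1$ is an integer, $p>2$, $\phi_q(\xi):=|\xi|^{q-2}\xi$ (with $\phi_q(0)=0$) for $q>1$, $p':=p/(p-1)$, and $Y:=C^0[0,1]$ with sup norm $|\cdot|_0$. The function $f:[0,\infty)\times\mathbb{R}\to\mathbb{R}$ is continuous with $f(r,0)=0$ for all $r\in[0,1]$, $\partial_2f$ is its partial derivative in the second variable $\xi$, and $f_0\in C^0[0,1]$ with $f_0>0$ on $[0,1]$. The hypotheses are: - (H1) $f(r,\cdot)\in C^1(\mathbb{R})$ for all $r\in[0,1]$ and $\partial_2f\in C^0([0,1]\times\mathbb{R})$. - (H4) $\lim_{\xi\to0^+}|f(\cdot,\xi)/\phi_p(\xi)-f_0|_0=\lim_{\xi\to0^+}|\partial_2f(\cdot,\xi)/\xi^{p-2}-(p-1)f_0|_0=0$. $f(u)$ denotes the function $r\mapsto f(r,u(r))$ for $u\in Y$. The operator $S_p:Y\to C^1[0,1]$ is $S_p(h)(r):=\int_r^1\phi_{p'}\big(\int_0^s(t/s)^{N-1}h(t)\,\mathrm{d}t\big)\mathrm{d}s$.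 $\lambda_0>0$ is the unique (and simple) eigenvalue with an eigenfunction positive on $[0,1)$ of $-(r^{N-1}\phi_p(v'))'=\lambda r^{N-1}f_0(r)\phi_p(v)$ for $0<r<1$, $v'(0)=v(1)=0$; its existence and uniqueness are known. $v_0$ is the corresponding eigenfunction, positive on $[0,1)$ and normalized by $\int_0^1r^{N-1}f_0(r)|v_0(r)|^p\,\mathrm{d}r=1$. Set $$Z:=\Big\{z\in Y:\int_0^1r^{N-1}f_0|v_0|^{p-2}v_0z\,\mathrm{d}r=0\Big\},$$ and define $G:\mathbb{R}^2\times Z\to Y$ by $G(s,\lambda,z):=v_0+z-S_p\big(\lambda f(sv_0+sz)/\phi_p(s)\big)$ for $s\ne0$, and $G(0,\lambda,z):=v_0+z-S_p\big(\lambda f_0\phi_p(v_0+z)\big)$.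
   Formalization: (H4) is also assumed as ξ→0⁻ (with |ξ|^{p-2} in place of ξ^{p-2}); with only ξ→0⁺ the claim is false, e.g. p=4, f_0=1, f=ξ³ for ξ≥0 and f=−ξ² for ξ<0, where no continuous curve exists for s<0. *)

theory Defs
  imports "HOL-Analysis.Analysis"
begin

section \<open>The Banach space of continuous functions on the unit interval\<close>

typedef unit_interval = "{0..1::real}" morphisms ui_real ui_of
  by (rule exI[of _ 0]) simp

instantiation unit_interval :: metric_space
begin

definition dist_unit_interval :: "unit_interval \<Rightarrow> unit_interval \<Rightarrow> real"
  where "dist_unit_interval x y = dist (ui_real x) (ui_real y)"

definition uniformity_unit_interval :: "(unit_interval \<times> unit_interval) filter"
  where "uniformity_unit_interval = (INF e\<in>{0 <..}. principal {(x, y). dist x y < e})"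

definition open_unit_interval :: "unit_interval set \<Rightarrow> bool"
  where "open_unit_interval S = (\<forall>x\<in>S. \<forall>\<^sub>F (x', y) in uniformity. x' = x \<longrightarrow> y \<in> S)"

instance
proof
  fix x y z :: unit_interval
  show "dist x y = 0 \<longleftrightarrow> x = y"
    by (simp add: dist_unit_interval_def ui_real_inject)
  show "dist x y \<le> dist x z + dist y z"
    unfolding dist_unit_interval_def by (rule dist_triangle2)
qed (rule open_unit_interval_def uniformity_unit_interval_def)+

end

text \<open>Since the unit interval is compact, the bounded continuous functions on it are all the
  continuous ones, and the norm of this type is the sup norm.\<close>

type_synonym C01 = "unit_interval \<Rightarrow>\<^sub>C real"

text \<open>Values of \<^term>\<open>val u r\<close> are only meaningful for \<open>r\<close> in \<open>[0,1]\<close> (outside, \<open>r\<close> is moved to the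
  nearest endpoint); \<open>restr01 g\<close> is the restriction of \<open>g\<close> to \<open>[0,1]\<close> and is only meaningful if that
  restriction is continuous.\<close>

definition val :: "C01 \<Rightarrow> real \<Rightarrow> real"
  where "val u r = apply_bcontfun u (ui_of (max 0 (min 1 r)))"

definition restr01 :: "(real \<Rightarrow> real) \<Rightarrow> C01"
  where "restr01 g = Bcontfun (\<lambda>x. g (ui_real x))"

lemma ui_real_bounds [simp]: "0 \<le> ui_real x" "ui_real x \<le> 1"
  using ui_real[of x] by auto

lemma val_ui_real: "val u (ui_real x) = apply_bcontfun u x"
  by (simp add: val_def ui_real_inverse)

lemma continuous_on_ui_real: "continuous_on S ui_real"
  unfolding continuous_on_iff dist_unit_interval_def by blast

lemma continuous_on_ui_of: "continuous_on {0..1} ui_of"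
  unfolding continuous_on_iff dist_unit_interval_def
  by (auto simp: ui_of_inverse)

lemma continuous_on_val [continuous_intros]: "continuous_on S (val u)"
proof -
  have "continuous_on S (\<lambda>r. max 0 (min 1 r) :: real)"
    by (intro continuous_intros)
  then have "continuous_on S (\<lambda>r. ui_of (max 0 (min 1 r)))"
    by (rule continuous_on_compose2[OF continuous_on_ui_of]) auto
  then have "continuous_on S (\<lambda>r. apply_bcontfun u (ui_of (max 0 (min 1 r))))"
    by (rule continuous_on_compose2[OF continuous_on_apply_bcontfun[of UNIV]]) auto
  then show ?thesis
    by (simp add: val_def[abs_def])
qed

lemma restr01_mem_bcontfun:
  assumes "continuous_on {0..1} g"
  shows "(\<lambda>x. g (ui_real x)) \<in> bcontfun"
proof -
  have "continuous_on UNIV (\<lambda>x. g (ui_real x))"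
    by (rule continuous_on_compose2[OF assms continuous_on_ui_real]) auto
  moreover have "bounded (g ` {0..1})"
    using assms by (intro compact_imp_bounded compact_continuous_image) auto
  then have "bounded (range (\<lambda>x. g (ui_real x)))"
    by (rule bounded_subset) auto
  ultimately show ?thesis
    by (simp add: bcontfun_def)
qed

lemma val_restr01:
  assumes "continuous_on {0..1} g" "r \<in> {0..1}"
  shows "val (restr01 g) r = g r"
  using assms
  by (simp add: val_def restr01_def Bcontfun_inverse[OF restr01_mem_bcontfun] ui_of_inverse)

lemma restr01_val: "restr01 (val u) = u"
  by (simp add: restr01_def val_ui_real apply_bcontfun_inverse)

lemma norm_C01_eq: "norm (u :: C01) = (SUP r\<in>{0..1}. \<bar>val u r\<bar>)"
proof -
  have "norm u = (SUP x. dist (apply_bcontfun u x) (apply_bcontfun 0 x))"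
    by (simp only: dist_bcontfun.rep_eq[symmetric] dist_norm[of u] diff_0_right)
  also have "\<dots> = (SUP x. \<bar>val u (ui_real x)\<bar>)"
    by (simp add: val_ui_real)
  also have "range (\<lambda>x. \<bar>val u (ui_real x)\<bar>) = (\<lambda>r. \<bar>val u r\<bar>) ` {0..1}"
    unfolding type_definition.Rep_range[OF type_definition_unit_interval, symmetric] image_image ..
  finally show ?thesis .
qed

section \<open>The radial \<open>p\<close>-Laplacian problem\<close>

definition phi :: "real \<Rightarrow> real \<Rightarrow> real"
  where "phi q x = \<bar>x\<bar> powr (q - 2) * x"

definition S_p :: "real \<Rightarrow> nat \<Rightarrow> C01 \<Rightarrow> C01"
  where "S_p p N h = restr01 (\<lambda>r. integral {r..1} (\<lambda>s.
    phi (p / (p - 1)) (integral {0..s} (\<lambda>t. (t / s) ^ (N - 1) * val h t))))"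

definition positive_eigenfunction :: "real \<Rightarrow> nat \<Rightarrow> C01 \<Rightarrow> real \<Rightarrow> C01 \<Rightarrow> bool"
  where "positive_eigenfunction p N f0 lam v \<longleftrightarrow>
    (\<exists>v'. continuous_on {0..1} v' \<and>
      (\<forall>r\<in>{0..1}. (val v has_real_derivative v' r) (at r within {0..1})) \<and>
      (\<forall>r\<in>{0<..<1}. ((\<lambda>r. r ^ (N - 1) * phi p (v' r)) has_real_derivative
        - (lam * r ^ (N - 1) * val f0 r * phi p (val v r))) (at r)) \<and>
      v' 0 = 0 \<and> val v 1 = 0) \<and>
    (\<forall>r\<in>{0..<1}. val v r > 0)"

definition Z :: "real \<Rightarrow> nat \<Rightarrow> C01 \<Rightarrow> C01 \<Rightarrow> C01 set"
  where "Z p N f0 v0 = {z. integral {0..1}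
    (\<lambda>r. r ^ (N - 1) * val f0 r * \<bar>val v0 r\<bar> powr (p - 2) * val v0 r * val z r) = 0}"

definition G :: "real \<Rightarrow> nat \<Rightarrow> (real \<Rightarrow> real \<Rightarrow> real) \<Rightarrow> C01 \<Rightarrow> C01 \<Rightarrow> real \<Rightarrow> real \<Rightarrow> C01 \<Rightarrow> C01"
  where "G p N f f0 v0 s lam z =
    (if s \<noteq> 0
     then v0 + z - S_p p N (restr01 (\<lambda>r. lam * f r (s * val v0 r + s * val z r) / phi p s))
     else v0 + z - S_p p N (restr01 (\<lambda>r. lam * val f0 r * phi p (val v0 r + val z r))))"

definition d2 :: "(real \<Rightarrow> real \<Rightarrow> real) \<Rightarrow> real \<Rightarrow> real \<Rightarrow> real"
  where "d2 f r \<xi> = deriv (f r) \<xi>"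

definition H1 :: "(real \<Rightarrow> real \<Rightarrow> real) \<Rightarrow> bool"
  where "H1 f \<longleftrightarrow>
    (\<forall>r\<in>{0..1}. \<forall>\<xi>. f r field_differentiable at \<xi>) \<and>
    (\<forall>r\<in>{0..1}. continuous_on UNIV (d2 f r)) \<and>
    continuous_on ({0..1} \<times> UNIV) (\<lambda>(r, \<xi>). d2 f r \<xi>)"

definition H4 :: "real \<Rightarrow> (real \<Rightarrow> real \<Rightarrow> real) \<Rightarrow> C01 \<Rightarrow> bool"
  where "H4 p f f0 \<longleftrightarrow>
    ((\<lambda>\<xi>. norm (restr01 (\<lambda>r. f r \<xi> / phi p \<xi>) - f0)) \<longlongrightarrow> 0) (at_right 0) \<and>
    ((\<lambda>\<xi>. norm (restr01 (\<lambda>r. d2 f r \<xi> / \<xi> powr (p - 2)) - (p - 1) *\<^sub>R f0)) \<longlongrightarrow> 0) (at_right 0)"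

text \<open>The mirror image of \<^term>\<open>H4 p f f0\<close> at \<open>0-\<close>; it follows from \<^term>\<open>H4 p f f0\<close> if
  \<open>f r\<close> is odd for all \<open>r\<close> in \<open>[0,1]\<close>. The bifurcation statement is false without it. For example,
  take \<open>p = 4\<close>, \<open>f r \<xi> = \<xi>^3\<close> for \<open>\<xi> \<ge> 0\<close> and \<open>f r \<xi> = - \<xi>^2\<close> for \<open>\<xi> < 0\<close>, and \<open>f0 = 1\<close>. For
  \<open>s < 0\<close> and \<open>v0 + z > 0\<close> one has \<open>f r (s * (v0 + z)) / phi p s = (v0 + z)^2 / \<bar>s\<bar>\<close>, which is
  unbounded as \<open>s\<close> tends to \<open>0\<close>, so there are no zeros of \<open>G\<close> near \<open>(0, \<lambda>0, 0)\<close> with \<open>s < 0\<close>.\<close>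

definition H4_left :: "real \<Rightarrow> (real \<Rightarrow> real \<Rightarrow> real) \<Rightarrow> C01 \<Rightarrow> bool"
  where "H4_left p f f0 \<longleftrightarrow>
    ((\<lambda>\<xi>. norm (restr01 (\<lambda>r. f r \<xi> / phi p \<xi>) - f0)) \<longlongrightarrow> 0) (at_left 0) \<and>
    ((\<lambda>\<xi>. norm (restr01 (\<lambda>r. d2 f r \<xi> / \<bar>\<xi>\<bar> powr (p - 2)) - (p - 1) *\<^sub>R f0)) \<longlongrightarrow> 0) (at_left 0)"

section \<open>The arguments of \<open>restr01\<close> above are continuous\<close>

lemma phi_0 [simp]: "phi q 0 = 0"
  by (simp add: phi_def)

lemma phi_minus: "phi q (- x) = - phi q x"
  by (simp add: phi_def)

lemma abs_phi: "\<bar>phi q x\<bar> = \<bar>x\<bar> powr (q - 1)"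
proof (cases "x = 0")
  case False
  then have "\<bar>x\<bar> powr (q - 1) = \<bar>x\<bar> powr (q - 2) * \<bar>x\<bar> powr 1"
    by (subst powr_add[symmetric]) simp
  then show ?thesis
    using False by (simp add: phi_def abs_mult)
qed simp

lemma isCont_phi:
  assumes "q > 1"
  shows "isCont (phi q) x"
proof (cases "x = 0")
  case True
  have "((\<lambda>x. \<bar>x\<bar> powr (q - 1)) \<longlongrightarrow> \<bar>0::real\<bar> powr (q - 1)) (at 0)"
    using assms by (intro tendsto_powr' tendsto_intros) auto
  then have "((\<lambda>x. \<bar>phi q x\<bar>) \<longlongrightarrow> 0) (at 0)"
    by (simp add: abs_phi)
  then show ?thesis
    using True by (simp add: isCont_def tendsto_rabs_zero_iff)
next
  case False
  then show ?thesis
    unfolding phi_def[abs_def] by (intro continuous_intros) auto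
qed

lemma continuous_on_phi [continuous_intros]:
  assumes "q > 1" "continuous_on A g"
  shows "continuous_on A (\<lambda>x. phi q (g x))"
proof -
  have "continuous_on UNIV (phi q)"
    using isCont_phi[OF assms(1)] by (simp add: continuous_at_imp_continuous_on)
  then show ?thesis
    by (rule continuous_on_compose2[OF _ assms(2)]) auto
qed

lemma continuous_on_inner_integral:
  "continuous_on {0..1} (\<lambda>s. integral {0..s} (\<lambda>t. (t / s) ^ n * val h t))"
    (is "continuous_on _ ?J")
proof -
  let ?I = "\<lambda>s. integral {0..s} (\<lambda>t. t ^ n * val h t)"
  have J: "?J s = ?I s / s ^ n" for s
  proof -
    have "(\<lambda>t. (t / s) ^ n * val h t) = (\<lambda>t. (1 / s ^ n) * (t ^ n * val h t))"
      by (simp add: power_divide)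
    then have "?J s = integral {0..s} (\<lambda>t. (1 / s ^ n) * (t ^ n * val h t))"
      by simp
    also have "\<dots> = (1 / s ^ n) * ?I s"
      by (rule integral_mult_right)
    finally show ?thesis
      by simp
  qed
  have I: "continuous_on {0..1} ?I"
    by (intro indefinite_integral_continuous_1 integrable_continuous_real continuous_intros)
  have bound: "norm (?J s) \<le> norm h * s" if s: "s \<in> {0..1}" for s
  proof -
    have "norm (?J s) \<le> norm h * (s - 0)"
    proof (rule integral_bound)
      show "0 \<le> s" using s by simp
      show "continuous_on {0..s} (\<lambda>t. (t / s) ^ n * val h t)"
        unfolding power_divide divide_inverse by (intro continuous_intros)
      fix t assume t: "t \<in> {0..s}"
      have "\<bar>t / s\<bar> ^ n \<le> 1"
        using t by (intro power_le_one) (auto simp: divide_le_eq_1)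
      moreover have "\<bar>val h t\<bar> \<le> norm h"
        unfolding val_def real_norm_def[symmetric] by (rule norm_bounded)
      ultimately show "norm ((t / s) ^ n * val h t) \<le> norm h"
        using mult_mono[of "\<bar>t / s\<bar> ^ n" 1 "\<bar>val h t\<bar>" "norm h"]
        by (simp add: abs_mult power_abs)
    qed
    then show ?thesis by simp
  qed
  have "continuous (at s within {0..1}) ?J" if s: "s \<in> {0..1}" for s
  proof (cases "s = 0")
    case False
    have "continuous (at s within {0..1}) ?I"
      using I s by (simp add: continuous_on_eq_continuous_within)
    then show ?thesis
      unfolding J[abs_def] using False by (intro continuous_intros) auto
  next
    case True
    have "((\<lambda>s. norm h * s) \<longlongrightarrow> norm h * 0) (at 0 within {0..1})"
      by (intro tendsto_intros)
    then have "(?J \<longlongrightarrow> 0) (at 0 within {0..1})"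
      using bound
      by (intro Lim_null_comparison[of ?J "\<lambda>s. norm h * s"])
        (simp_all add: eventually_at_filter del: real_norm_def)
    then show ?thesis
      using True by (simp add: continuous_within)
  qed
  then show ?thesis
    by (simp add: continuous_on_eq_continuous_within)
qed

lemma val_S_p:
  assumes "p > 1" "r \<in> {0..1}"
  shows "val (S_p p N h) r = integral {r..1} (\<lambda>s.
    phi (p / (p - 1)) (integral {0..s} (\<lambda>t. (t / s) ^ (N - 1) * val h t)))"
  unfolding S_p_def
proof (rule val_restr01[OF _ assms(2)])
  have "p / (p - 1) > 1"
    using assms by simp
  then show "continuous_on {0..1} (\<lambda>r. integral {r..1} (\<lambda>s.
    phi (p / (p - 1)) (integral {0..s} (\<lambda>t. (t / s) ^ (N - 1) * val h t))))"
    by (intro indefinite_integral_continuous_1' integrable_continuous_real continuous_on_phi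
        continuous_on_inner_integral)
qed

lemma continuous_on_superposition:
  assumes "continuous_on ({0..} \<times> UNIV) (\<lambda>(r, \<xi>). f r \<xi>)"
    and "continuous_on {0..1} u"
  shows "continuous_on {0..1} (\<lambda>r. f r (u r) :: real)"
proof -
  have "continuous_on {0..1} (\<lambda>r. (r, u r))"
    by (intro continuous_intros assms(2))
  moreover have "(\<lambda>r. (r, u r)) ` {0..1} \<subseteq> {0..} \<times> UNIV"
    by auto
  ultimately show ?thesis
    using continuous_on_compose2[OF assms(1)] by fastforce
qed

lemma continuous_on_G_argument:
  assumes "continuous_on ({0..} \<times> UNIV) (\<lambda>(r, \<xi>). f r \<xi>)"
  shows "continuous_on {0..1} (\<lambda>r. lam * f r (s * val v0 r + s * val z r) / phi p s)"
proof -
  have "continuous_on {0..1} (\<lambda>r. f r (s * val v0 r + s * val z r))"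
    by (rule continuous_on_superposition[OF assms]) (intro continuous_intros)
  then show ?thesis
    unfolding divide_inverse by (intro continuous_on_mult continuous_on_const)
qed

lemma continuous_on_G0_argument:
  assumes "p > 2"
  shows "continuous_on {0..1} (\<lambda>r. lam * val f0 r * phi p (val v0 r + val z r))"
  using assms by (intro continuous_intros) auto

lemma continuous_on_H4_arguments:
  assumes "continuous_on ({0..} \<times> UNIV) (\<lambda>(r, \<xi>). f r \<xi>)" "H1 f"
  shows "continuous_on {0..1} (\<lambda>r. f r \<xi> / phi p \<xi>)"
    and "continuous_on {0..1} (\<lambda>r. d2 f r \<xi> / c)"
proof -
  have "continuous_on {0..1} (\<lambda>r. f r \<xi>)"
    by (rule continuous_on_superposition[OF assms(1)]) (rule continuous_on_const)
  then show "continuous_on {0..1} (\<lambda>r. f r \<xi> / phi p \<xi>)"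
    unfolding divide_inverse by (intro continuous_on_mult continuous_on_const)
  have d2: "continuous_on ({0..1} \<times> UNIV) (\<lambda>(r, \<xi>). d2 f r \<xi>)"
    using assms(2) by (simp add: H1_def)
  have "continuous_on {0..1} (\<lambda>r. (r, \<xi>))"
    by (intro continuous_intros)
  moreover have "(\<lambda>r. (r, \<xi>)) ` {0..1} \<subseteq> {0..1} \<times> UNIV"
    by auto
  ultimately have "continuous_on {0..1} (\<lambda>r. d2 f r \<xi>)"
    using continuous_on_compose2[OF d2] by fastforce
  then show "continuous_on {0..1} (\<lambda>r. d2 f r \<xi> / c)"
    unfolding divide_inverse by (intro continuous_on_mult continuous_on_const)
qed

end

theory Submission
  imports Defs
begin

text \<open>Write \<open>h0 = lam0 * f0 * phi p v0\<close>, so that \<open>v0 = S_p h0\<close>. The inner integral of \<open>S_p k\<close> equals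
  \<open>s * w s\<close> for a weighted average \<open>w\<close> of \<open>k\<close> over \<open>[0,s]\<close>. For \<open>k\<close> near \<open>h0\<close> the function \<open>w\<close> is
  bounded below by a positive constant, since \<open>v0 > 0\<close> on \<open>[0,1)\<close>, and therefore \<open>S_p\<close> is strictly
  differentiable at \<open>h0\<close>, although \<open>phi (p / (p - 1))\<close> is not differentiable at \<open>0\<close>. By the
  hypotheses on \<open>f\<close> near \<open>\<xi> = 0\<close>, the map \<open>G\<close> is strictly differentiable in \<open>(\<lambda>, z)\<close> uniformly in
  small \<open>s\<close>, and continuous in \<open>s\<close>, so the contraction principle applies once the derivative is
  shown to be invertible from \<open>\<real> \<times> Z\<close> to \<open>C[0,1]\<close>. The derivative is a linear Sturm--Liouville
  problem with the known solution \<open>v0\<close>: the Wronskian with \<open>v0\<close> shows that it is injective, and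
  variation of constants inverts it explicitly.\<close>

section \<open>Continuous functions on the unit interval\<close>

text \<open>At \<open>s = 0\<close> the hypotheses give limits of quotients but no derivative in
  \<open>s\<close>, so \<open>s\<close> can only be a parameter and the curve is only continuous.
  The derivative of \<open>phi (p / (p - 1))\<close> blows up at \<open>0\<close> because
  \<open>1 / (p - 1) < 1\<close>, and every inner integral vanishes at \<open>s = 0\<close>; with
  the factor \<open>s\<close> split off, this singularity is the same for all \<open>k\<close>. In
  the linearization the factor \<open>p - 1\<close> from \<open>phi p\<close> cancels the factor
  \<open>1 / (p - 1)\<close> from its inverse. The resulting linear operator \<open>K\<close>
  therefore fixes \<open>v0\<close>, and \<open>z - K z\<close> is not invertible on
  \<open>C01\<close>: its kernel is spanned by \<open>v0\<close> and its range is \<open>Z\<close>.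
  Restricting \<open>z\<close> to \<open>Z\<close> removes the kernel, and varying \<lambda>
  supplies the missing direction \<open>v0\<close>. The explicit inversion also yields the norm
  bound that the contraction needs. The delicate point is \<open>r = 1\<close>, where variation of
  constants divides by \<open>v0\<^sup>2\<close> although \<open>v0\<close> vanishes. There
  \<open>v0\<close> has a nonzero slope, and orthogonality gives decay of order
  \<open>v0 powr p\<close> with \<open>p > 2\<close>.\<close>

lemma val_add [simp]: "val (u + v) r = val u r + val v r"
  by (simp add: val_def)

lemma val_diff [simp]: "val (u - v) r = val u r - val v r"
  by (simp add: val_def)

lemma val_scaleR [simp]: "val (c *\<^sub>R u) r = c * val u r"
  by (simp add: val_def)

lemma abs_val_le_norm: "\<bar>val u r\<bar> \<le> norm u"
  unfolding val_def real_norm_def[symmetric] by (rule norm_bounded)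

lemma norm_C01_le:
  assumes "\<And>r. r \<in> {0..1} \<Longrightarrow> \<bar>val u r\<bar> \<le> b"
  shows "norm u \<le> b"
  unfolding norm_C01_eq by (rule cSUP_least) (use assms in auto)

lemma C01_eqI:
  assumes "\<And>r. r \<in> {0..1} \<Longrightarrow> val u r = val v r"
  shows "u = v"
  using norm_C01_le[of "u - v" 0] assms by simp

text \<open>Compactness of \<open>[0,1]\<close> makes the continuity in \<open>s\<close> uniform in
  \<open>r\<close>, which is what the sup norm requires.\<close>

lemma continuous_on_restr01_param:
  fixes g :: "real \<Rightarrow> 'a::topological_space \<Rightarrow> real"
  assumes cont: "continuous_on (S \<times> {0..1}) (\<lambda>(s, r). g r s)"
  shows "continuous_on S (\<lambda>s. restr01 (\<lambda>r. g r s))"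
  unfolding continuous_on_topological
proof (intro ballI allI impI)
  have slice: "continuous_on {0..1} (\<lambda>r. g r s)" if "s \<in> S" for s
  proof -
    have "continuous_on {0..1} (\<lambda>r. case (s, r) of (s, r) \<Rightarrow> g r s)"
      by (rule continuous_on_compose2[OF cont]) (use that in \<open>auto intro!: continuous_intros\<close>)
    then show ?thesis by simp
  qed
  fix s0 B assume s0: "s0 \<in> S" and B: "open B" "restr01 (\<lambda>r. g r s0) \<in> B"
  then obtain e where e: "e > 0" "ball (restr01 (\<lambda>r. g r s0)) e \<subseteq> B"
    using openE by blast
  obtain X where X: "s0 \<in> X" "open X"
      "\<forall>s\<in>X \<inter> S. \<forall>r\<in>{0..1}. dist (case (s, r) of (s, r) \<Rightarrow> g r s) (case (s0, r) of (s, r) \<Rightarrow> g r s) \<le> e / 2"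
    by (rule continuous_on_prod_compactE[OF cont compact_Icc s0, of "e/2"]) (use e in auto)
  have "restr01 (\<lambda>r. g r s) \<in> B" if "s \<in> S" "s \<in> X" for s
  proof -
    have "norm (restr01 (\<lambda>r. g r s) - restr01 (\<lambda>r. g r s0)) \<le> e / 2"
      by (rule norm_C01_le) (use X that s0 slice in \<open>auto simp: val_restr01 dist_real_def\<close>)
    then have "restr01 (\<lambda>r. g r s) \<in> ball (restr01 (\<lambda>r. g r s0)) e"
      using e by (simp add: dist_norm norm_minus_commute)
    then show ?thesis using e by blast
  qed
  then show "\<exists>A. open A \<and> s0 \<in> A \<and> (\<forall>y\<in>S. y \<in> A \<longrightarrow> restr01 (\<lambda>r. g r y) \<in> B)"
    using X by blast
qed

section \<open>Radial averages\<close>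

text \<open>Rescaling to the fixed interval \<open>[0,1]\<close> keeps the average continuous at
  \<open>s = 0\<close> without a case distinction. The weight has total mass \<open>1 / N\<close>,
  so that \<open>s * avg N h s\<close> is exactly the inner integral of \<open>S_p\<close>.\<close>

definition avg :: "nat \<Rightarrow> (real \<Rightarrow> real) \<Rightarrow> real \<Rightarrow> real"
  where "avg N h s = integral {0..1} (\<lambda>t. t ^ (N - 1) * h (s * t))"

lemma continuous_on_scaled:
  assumes "continuous_on {0..1} h" "s \<in> {0..1::real}"
  shows "continuous_on {0..1} (\<lambda>t. h (s * t) :: real)"
  by (rule continuous_on_compose2[OF assms(1)])
    (use assms(2) in \<open>auto intro!: continuous_intros mult_le_one\<close>)

lemma avg_integrable:
  fixes h :: "real \<Rightarrow> real"
  assumes "continuous_on {0..1} h" "s \<in> {0..1}"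
  shows "(\<lambda>t. t ^ (N - 1) * h (s * t)) integrable_on {0..1}"
  by (intro integrable_continuous_real continuous_on_mult continuous_on_power continuous_on_id
      continuous_on_scaled[OF assms])

lemma continuous_on_avg [continuous_intros]:
  assumes "continuous_on {0..1} h"
  shows "continuous_on {0..1} (avg N h)"
proof -
  have "continuous_on ({0..1} \<times> cbox 0 1) (\<lambda>(s, t). t ^ (N - 1) * h (s * t))"
    unfolding case_prod_unfold
    by (intro continuous_intros continuous_on_compose2[OF assms])
      (auto intro!: continuous_intros mult_le_one)
  from integral_continuous_on_param[OF this] show ?thesis
    by (simp add: avg_def[abs_def])
qed

lemma avg_diff:
  assumes "continuous_on {0..1} g" "continuous_on {0..1} h" "s \<in> {0..1}"
  shows "avg N (\<lambda>t. g t - h t) s = avg N g s - avg N h s"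
  unfolding avg_def right_diff_distrib
  by (rule integral_diff[OF avg_integrable[OF assms(1,3)] avg_integrable[OF assms(2,3)]])

lemma avg_cmult: "avg N (\<lambda>t. c * h t) s = c * avg N h s"
  unfolding avg_def by (subst integral_mult_right[symmetric]) (simp add: algebra_simps)

lemma avg_cong:
  assumes "\<And>t. t \<in> {0..1} \<Longrightarrow> g t = h t" "s \<in> {0..1}"
  shows "avg N g s = avg N h s"
  unfolding avg_def
  by (rule integral_cong) (use assms in \<open>auto simp: mult_le_one\<close>)

lemma abs_avg_le:
  assumes "continuous_on {0..1} h" "\<And>t. t \<in> {0..1} \<Longrightarrow> \<bar>h t\<bar> \<le> B" "s \<in> {0..1}"
  shows "\<bar>avg N h s\<bar> \<le> B"
proof -
  have "norm (integral {0..1} (\<lambda>t. t ^ (N - 1) * h (s * t))) \<le> B * (1 - 0)"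
  proof (rule integral_bound)
    show "continuous_on {0..1} (\<lambda>t. t ^ (N - 1) * h (s * t))"
      by (intro continuous_on_mult continuous_on_power continuous_on_id
          continuous_on_scaled[OF assms(1,3)])
    fix t :: real assume t: "t \<in> {0..1}"
    have "\<bar>h (s * t)\<bar> \<le> B"
      using t assms(3) by (intro assms(2)) (auto simp: mult_le_one)
    moreover have "\<bar>t ^ (N - 1)\<bar> \<le> 1"
      using t by (auto intro: power_le_one)
    ultimately show "norm (t ^ (N - 1) * h (s * t)) \<le> B"
      using mult_mono[of "\<bar>t ^ (N - 1)\<bar>" 1 "\<bar>h (s * t)\<bar>" B] by (simp add: abs_mult)
  qed simp
  then show ?thesis by (simp add: avg_def)
qed

lemma integral_power_eq_avg:
  assumes "continuous_on {0..1} h" "s \<in> {0..1}" "N \<ge> 1"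
  shows "integral {0..s} (\<lambda>t. t ^ (N - 1) * h t) = s ^ N * avg N h s"
proof -
  have "((\<lambda>x. s *\<^sub>R ((s * x) ^ (N - 1) * h (s * x))) has_integral
      integral {s * 0..s * 1} (\<lambda>t. t ^ (N - 1) * h t)) {0..1}"
    by (rule has_integral_substitution[where c = 0 and d = 1])
      (use assms in \<open>auto intro!: continuous_intros derivative_eq_intros mult_le_one\<close>)
  then have "((\<lambda>x. s ^ N * (x ^ (N - 1) * h (s * x))) has_integral
      integral {0..s} (\<lambda>t. t ^ (N - 1) * h t)) {0..1}"
    using \<open>N \<ge> 1\<close> by (cases N) (simp_all add: power_mult_distrib mult_ac)
  then show ?thesis
    by (simp only: avg_def integral_mult_right[symmetric] integral_unique)
qed

lemma integral_ratio_eq_avg: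
  assumes "continuous_on {0..1} h" "s \<in> {0..1}" "N \<ge> 1"
  shows "integral {0..s} (\<lambda>t. (t / s) ^ (N - 1) * h t) = s * avg N h s"
proof (cases "s = 0")
  case False
  have "integral {0..s} (\<lambda>t. (t / s) ^ (N - 1) * h t)
      = integral {0..s} (\<lambda>t. (1 / s ^ (N - 1)) * (t ^ (N - 1) * h t))"
    by (simp add: power_divide)
  also have "\<dots> = (1 / s ^ (N - 1)) * (s ^ N * avg N h s)"
    by (simp only: integral_mult_right integral_power_eq_avg[OF assms])
  also have "\<dots> = s * avg N h s"
    using False \<open>N \<ge> 1\<close> by (simp add: power_eq_if[of s N])
  finally show ?thesis .
qed simp

section \<open>A parametrized implicit function theorem\<close>

text \<open>Zeros of \<open>F s\<close> in \<open>V\<close> are the fixed points of a Newton map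
  \<open>x - L (F s x)\<close>, where \<open>L\<close> inverts \<open>T\<close> and is the same for
  all \<open>s\<close>. The strict estimate makes this map a contraction of one ball for all small
  \<open>s\<close>. As \<open>F\<close> is continuous in \<open>s\<close> only for each fixed
  \<open>x\<close>, continuity of the curve comes from estimating residuals.\<close>

lemma implicit_function_continuous_parameter:
  fixes F :: "real \<Rightarrow> 'a::{real_normed_vector, complete_space} \<Rightarrow> 'b::real_normed_vector" and T :: "'a \<Rightarrow> 'b"
  assumes V: "subspace V" "closed V" and "x0 \<in> V" and "linear T"
    and surj: "\<And>y. \<exists>x\<in>V. T x = y"
    and bound: "\<And>x. x \<in> V \<Longrightarrow> norm x \<le> C * norm (T x)"
    and F0: "F 0 x0 = 0"
    and strict: "\<And>\<eta>. \<eta> > 0 \<Longrightarrow> \<exists>\<delta>>0. \<forall>s x y. \<bar>s\<bar> < \<delta> \<longrightarrow> x \<in> V \<longrightarrow> y \<in> V \<longrightarrow>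
        dist x x0 < \<delta> \<longrightarrow> dist y x0 < \<delta> \<longrightarrow> norm (F s x - F s y - T (x - y)) \<le> \<eta> * norm (x - y)"
    and cont: "\<exists>\<delta>>0. \<forall>x\<in>V. dist x x0 < \<delta> \<longrightarrow> continuous_on {-\<delta><..<\<delta>} (\<lambda>s. F s x)"
  shows "\<exists>\<epsilon>>0. \<exists>\<rho>>0. \<exists>x. continuous_on {-\<epsilon><..<\<epsilon>} x \<and> x 0 = x0 \<and>
    (\<forall>s\<in>{-\<epsilon><..<\<epsilon>}. x s \<in> V \<inter> ball x0 \<rho> \<and> (\<forall>y\<in>V \<inter> ball x0 \<rho>. F s y = 0 \<longleftrightarrow> y = x s))"
proof -
  \<comment> \<open>The hypothesis fixes no sign for \<open>C\<close>; the divisions below need a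
    positive constant.\<close>
  define C' where "C' = max C 1"
  have bound': "norm x \<le> C' * norm (T x)" if "x \<in> V" for x
    using order_trans[OF bound[OF that] mult_right_mono[of C C' "norm (T x)"]]
    by (auto simp: C'_def)
  have C': "C' > 0" by (simp add: C'_def)
  define L where "L y = (SOME x. x \<in> V \<and> T x = y)" for y
  have L: "L y \<in> V" "T (L y) = y" for y
    using someI_ex[of "\<lambda>x. x \<in> V \<and> T x = y"] surj[of y] by (auto simp: L_def)
  have normL: "norm (L y) \<le> C' * norm y" for y
    using bound'[OF L(1)] by (simp add: L(2))
  \<comment> \<open>With this choice of \<eta> the Newton map has Lipschitz constant
    \<open>C' * (1 / (2 * C')) = 1/2\<close>.\<close>
  obtain \<delta>1 where \<delta>1: "\<delta>1 > 0" and strict1: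
    "\<And>s x y. \<bar>s\<bar> < \<delta>1 \<Longrightarrow> x \<in> V \<Longrightarrow> y \<in> V \<Longrightarrow> dist x x0 < \<delta>1 \<Longrightarrow> dist y x0 < \<delta>1 \<Longrightarrow>
      norm (F s x - F s y - T (x - y)) \<le> (1 / (2 * C')) * norm (x - y)"
    using strict[of "1 / (2 * C')"] C' by auto
  obtain \<delta>2 where \<delta>2: "\<delta>2 > 0" and
    cont2: "\<And>x. x \<in> V \<Longrightarrow> dist x x0 < \<delta>2 \<Longrightarrow> continuous_on {-\<delta>2<..<\<delta>2} (\<lambda>s. F s x)"
    using cont by blast
  define \<rho> where "\<rho> = min \<delta>1 \<delta>2 / 2"
  have \<rho>: "\<rho> > 0" "\<rho> < \<delta>1" "\<rho> < \<delta>2"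
    using \<delta>1 \<delta>2 by (auto simp: \<rho>_def)
  have "\<exists>\<delta>3>0. \<forall>s. \<bar>s\<bar> < \<delta>3 \<longrightarrow> norm (F s x0) < \<rho> / (2 * C')"
  proof -
    have "isCont (\<lambda>s. F s x0) 0"
      using cont2[OF \<open>x0 \<in> V\<close>] \<delta>2 by (simp add: continuous_on_eq_continuous_at)
    then have "\<exists>d>0. \<forall>s. dist s 0 < d \<longrightarrow> dist (F s x0) (F 0 x0) < \<rho> / (2 * C')"
      unfolding continuous_at_eps_delta using \<rho> C' by (simp add: dist_norm)
    then show ?thesis by (simp add: F0 dist_norm)
  qed
  then obtain \<delta>3 where \<delta>3: "\<delta>3 > 0" and small: "\<And>s. \<bar>s\<bar> < \<delta>3 \<Longrightarrow> norm (F s x0) < \<rho> / (2 * C')"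
    by blast
  define \<epsilon> where "\<epsilon> = min \<delta>1 (min \<delta>2 \<delta>3)"
  have \<epsilon>: "\<epsilon> > 0" "\<epsilon> \<le> \<delta>1" "\<epsilon> \<le> \<delta>2" "\<epsilon> \<le> \<delta>3"
    using \<delta>1 \<delta>2 \<delta>3 by (auto simp: \<epsilon>_def)
  define K where "K = V \<inter> cball x0 \<rho>"
  have K: "complete K" "x0 \<in> K"
    using V \<rho> \<open>x0 \<in> V\<close> by (auto simp: K_def complete_eq_closed intro: closed_Int)
  define H where "H s x = x - L (F s x)" for s x
  have HV: "H s x \<in> V" if "x \<in> V" for s x
    unfolding H_def by (rule subspace_diff[OF V(1) that L(1)])
  have Tdiff: "T (x - y) = T x - T y" for x y
    using \<open>linear T\<close> by (rule linear_diff)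
  have contr: "dist (H s x) (H s y) \<le> (1/2) * dist x y"
    if "\<bar>s\<bar> < \<epsilon>" "x \<in> K" "y \<in> K" for s x y
  proof -
    have xy: "x \<in> V" "y \<in> V" "dist x x0 < \<delta>1" "dist y x0 < \<delta>1"
      using that \<rho> by (auto simp: K_def dist_commute)
    \<comment> \<open>\<open>L\<close> is only a choice of preimages, so the difference is measured
      through \<open>T\<close>: applying \<open>T\<close> cancels \<open>L\<close> and leaves the
      error of the strict derivative.\<close>
    have "T (H s x - H s y) = - (F s x - F s y - T (x - y))"
      by (simp add: H_def Tdiff L)
    then have "norm (H s x - H s y) \<le> C' * norm (F s x - F s y - T (x - y))"
      using bound'[OF subspace_diff[OF V(1) HV[OF xy(1)] HV[OF xy(2)]], of s s]
      by (simp only: norm_minus_cancel)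
    also have "\<dots> \<le> C' * ((1 / (2 * C')) * norm (x - y))"
      using C' that(1) \<epsilon> xy by (intro mult_left_mono strict1) auto
    finally show ?thesis using C' by (simp add: dist_norm)
  qed
  have x0_move: "dist (H s x0) x0 < \<rho> / 2" if "\<bar>s\<bar> < \<epsilon>" for s
  proof -
    have "dist (H s x0) x0 \<le> C' * norm (F s x0)"
      using normL by (simp add: H_def dist_norm)
    also have "\<dots> < C' * (\<rho> / (2 * C'))"
      using small[of s] that \<epsilon> C' by (intro mult_strict_left_mono) auto
    finally show ?thesis using C' by simp
  qed
  \<comment> \<open>The Newton map sends the closed ball, on which completeness is available, into
    the open ball, which becomes the neighbourhood.\<close>
  have ball: "H s x \<in> V \<inter> ball x0 \<rho>" if "\<bar>s\<bar> < \<epsilon>" "x \<in> K" for s x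
  proof -
    have "dist (H s x) x0 \<le> dist (H s x) (H s x0) + dist (H s x0) x0"
      by (rule dist_triangle)
    also have "\<dots> < (1/2) * dist x x0 + \<rho> / 2"
      using contr[OF that(1,2) K(2)] x0_move[OF that(1)] by simp
    also have "\<dots> \<le> \<rho>"
      using that(2) by (simp add: K_def dist_commute)
    finally show ?thesis
      using that(2) HV by (simp add: K_def dist_commute)
  qed
  have fixed_iff: "H s x = x \<longleftrightarrow> F s x = 0" if "x \<in> V" for s x
  proof
    assume "H s x = x"
    then have "L (F s x) = 0" by (simp add: H_def)
    then show "F s x = 0" using L(2)[of "F s x"] \<open>linear T\<close> by (simp add: linear_0)
  next
    assume "F s x = 0"
    then show "H s x = x" using normL[of 0] by (simp add: H_def)
  qed
  have ex1: "\<exists>!x\<in>K. H s x = x" if "\<bar>s\<bar> < \<epsilon>" for s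
  proof (rule Banach_fix)
    show "complete K" "K \<noteq> {}" "0 \<le> (1/2::real)" "(1/2::real) < 1"
      using K by auto
    show "H s ` K \<subseteq> K"
      using ball[OF that] unfolding K_def by fastforce
    show "dist (H s x) (H s y) \<le> 1/2 * dist x y" if "x \<in> K" "y \<in> K" for x y
      by (rule contr) fact+
  qed
  define X where "X s = (THE x. x \<in> K \<and> H s x = x)" for s
  have X: "X s \<in> K" "H s (X s) = X s" if "\<bar>s\<bar> < \<epsilon>" for s
    using theI'[OF ex1[OF that]] by (simp_all add: X_def)
  have X_unique: "x = X s" if "\<bar>s\<bar> < \<epsilon>" "x \<in> K" "H s x = x" for s x
    using ex1[OF that(1)] X[OF that(1)] that(2,3) by blast
  have F_X: "F s (X s) = 0" if "\<bar>s\<bar> < \<epsilon>" for s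
    using X[OF that] fixed_iff by (simp add: K_def)
  \<comment> \<open>The distance is controlled by the residual of \<open>F s\<close> at the fixed
    point for \<open>t\<close>, so continuity of \<open>F\<close> in \<open>s\<close> at the single
    point \<open>X t\<close> is enough.\<close>
  have lip: "dist (X s) (X t) \<le> 2 * C' * norm (F s (X t))" if "\<bar>s\<bar> < \<epsilon>" "\<bar>t\<bar> < \<epsilon>" for s t
  proof -
    have "dist (X s) (X t) \<le> dist (H s (X s)) (H s (X t)) + dist (H s (X t)) (X t)"
      using dist_triangle[of "H s (X s)" "X t" "H s (X t)"] X[OF that(1)] by simp
    also have "\<dots> \<le> 1/2 * dist (X s) (X t) + C' * norm (F s (X t))"
      using contr[OF that(1) X(1)[OF that(1)] X(1)[OF that(2)]] normL
      by (intro add_mono) (simp_all add: H_def dist_norm)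
    finally show ?thesis by simp
  qed
  have "isCont X t" if t: "t \<in> {-\<epsilon><..<\<epsilon>}" for t
  proof -
    have t': "\<bar>t\<bar> < \<epsilon>" using t by auto
    have "X t \<in> V" "dist (X t) x0 < \<delta>2"
      using X(1)[OF t'] \<rho> by (auto simp: K_def dist_commute)
    then have "isCont (\<lambda>s. F s (X t)) t"
      using cont2[of "X t"] t \<epsilon> by (simp add: continuous_on_eq_continuous_at)
    then have "((\<lambda>s. F s (X t)) \<longlongrightarrow> 0) (at t)"
      using F_X[OF t'] by (simp add: isCont_def)
    then have lim: "((\<lambda>s. 2 * C' * norm (F s (X t))) \<longlongrightarrow> 0) (at t)"
      by (intro tendsto_mult_right_zero tendsto_norm_zero)
    have "\<forall>\<^sub>F s in at t. s \<in> {-\<epsilon><..<\<epsilon>}"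
      using t by (intro eventually_at_in_open') auto
    then have "\<forall>\<^sub>F s in at t. dist (X s) (X t) \<le> 2 * C' * norm (F s (X t))"
      by eventually_elim (use lip t' in auto)
    then have "((\<lambda>s. dist (X s) (X t)) \<longlongrightarrow> 0) (at t)"
      by (intro Lim_null_comparison[OF _ lim]) simp
    then show ?thesis
      by (simp add: isCont_def tendsto_dist_iff[symmetric])
  qed
  then have "continuous_on {-\<epsilon><..<\<epsilon>} X"
    by (simp add: continuous_at_imp_continuous_on)
  moreover have "X 0 = x0"
    using X_unique[of 0 x0] K \<epsilon> fixed_iff[OF \<open>x0 \<in> V\<close>] F0 by simp
  moreover have "X s \<in> V \<inter> ball x0 \<rho> \<and> (\<forall>y\<in>V \<inter> ball x0 \<rho>. F s y = 0 \<longleftrightarrow> y = X s)"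
    if "s \<in> {-\<epsilon><..<\<epsilon>}" for s
  proof -
    have s: "\<bar>s\<bar> < \<epsilon>" using that by auto
    have "X s \<in> V \<inter> ball x0 \<rho>"
      using ball[OF s X(1)[OF s]] X(2)[OF s] by simp
    moreover have "F s y = 0 \<longleftrightarrow> y = X s" if "y \<in> V \<inter> ball x0 \<rho>" for y
      using that X_unique[OF s, of y] F_X[OF s] fixed_iff[of y s] by (auto simp: K_def)
    ultimately show ?thesis by blast
  qed
  ultimately show ?thesis
    using \<epsilon>(1) \<rho>(1) by blast
qed

text \<open>Subtracting \<open>d * x\<close> leaves a function whose derivative is at most \<eta> in
  absolute value. This turns closeness of derivatives into a strict-derivative estimate.\<close>

lemma mean_value_bound:
  fixes g :: "real \<Rightarrow> real"
  assumes "convex S" "x \<in> S" "y \<in> S"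
    and "\<And>z. z \<in> S \<Longrightarrow> (g has_real_derivative g' z) (at z)"
    and "\<And>z. z \<in> S \<Longrightarrow> \<bar>g' z - d\<bar> \<le> \<eta>"
  shows "\<bar>g x - g y - d * (x - y)\<bar> \<le> \<eta> * \<bar>x - y\<bar>"
proof -
  have "norm ((g x - d * x) - (g y - d * y)) \<le> \<eta> * norm (x - y)"
  proof (rule field_differentiable_bound[OF \<open>convex S\<close>, where f' = "\<lambda>z. g' z - d"])
    fix z assume "z \<in> S"
    from assms(4)[OF this] have "(g has_real_derivative g' z) (at z within S)"
      by (rule has_field_derivative_at_within)
    then show "((\<lambda>x. g x - d * x) has_real_derivative g' z - d) (at z within S)"
      by (auto intro!: derivative_eq_intros)
    show "norm (g' z - d) \<le> \<eta>"
      using assms(5)[OF \<open>z \<in> S\<close>] by simp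
  qed (rule assms)+
  then show ?thesis
    by (simp add: algebra_simps)
qed

section \<open>Strict differentiability of the solution operator\<close>

lemma phi_nonneg: "x \<ge> 0 \<Longrightarrow> phi q x = x powr (q - 1)"
  using abs_phi[of q x] by (simp add: phi_def)

lemma continuous_on_powr_nonneg:
  assumes "\<alpha> > 0" "continuous_on S u" "\<And>x. x \<in> S \<Longrightarrow> u x \<ge> 0"
  shows "continuous_on S (\<lambda>x. u x powr \<alpha> :: real)"
  using assms by (intro continuous_on_powr' continuous_on_const) auto

text \<open>The common form of the linear operators below: one choice of the weight \<open>m\<close>
  gives the derivative of \<open>S_p\<close> at \<open>h0\<close>, and the same operator composed
  with a multiplication gives the linearized eigenvalue problem.\<close>

definition avg_int :: "nat \<Rightarrow> (real \<Rightarrow> real) \<Rightarrow> C01 \<Rightarrow> C01"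
  where "avg_int N m k = restr01 (\<lambda>r. integral {r..1} (\<lambda>s. m s * avg N (val k) s))"

lemma continuous_on_avg_val [continuous_intros]: "continuous_on {0..1} (avg N (val k))"
  by (intro continuous_on_avg continuous_on_val)

lemma avg_val_diff:
  assumes "s \<in> {0..1}"
  shows "avg N (val (h - k)) s = avg N (val h) s - avg N (val k) s"
  unfolding avg_diff[OF continuous_on_val continuous_on_val assms, symmetric]
  by (simp add: avg_def)

lemma avg_val_scaleR: "avg N (val (c *\<^sub>R h)) s = c * avg N (val h) s"
  unfolding avg_cmult[symmetric] by (simp add: avg_def)

lemma abs_avg_val_le: "s \<in> {0..1} \<Longrightarrow> \<bar>avg N (val h) s\<bar> \<le> norm h"
  by (rule abs_avg_le[OF continuous_on_val abs_val_le_norm])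

lemma val_avg_int:
  assumes "continuous_on {0..1} m" "r \<in> {0..1}"
  shows "val (avg_int N m k) r = integral {r..1} (\<lambda>s. m s * avg N (val k) s)"
  unfolding avg_int_def
  by (intro val_restr01 indefinite_integral_continuous_1' integrable_continuous_real
      continuous_on_mult continuous_on_avg_val assms)

lemma tail_integrable:
  fixes g :: "real \<Rightarrow> real"
  assumes "continuous_on {0..1} g" "r \<in> {0..1}"
  shows "g integrable_on {r..1}"
  by (intro integrable_continuous_real continuous_on_subset[OF assms(1)]) (use assms(2) in auto)

lemma abs_tail_integral_le:
  fixes g :: "real \<Rightarrow> real"
  assumes "continuous_on {0..1} g" "r \<in> {0..1}" "\<And>s. s \<in> {0..1} \<Longrightarrow> \<bar>g s\<bar> \<le> B"
  shows "\<bar>integral {r..1} g\<bar> \<le> B"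
proof -
  have "norm (integral {r..1} g) \<le> B * (1 - r)"
    using assms by (intro integral_bound continuous_on_subset[OF assms(1)]) auto
  also have "\<dots> \<le> B * 1"
    using assms(2) order_trans[OF abs_ge_zero assms(3)[of 0]] by (intro mult_left_mono) auto
  finally show ?thesis by simp
qed

lemma linear_avg_int:
  assumes m: "continuous_on {0..1} m"
  shows "linear (avg_int N m)"
proof (rule linearI)
  have diff: "avg_int N m (x - y) = avg_int N m x - avg_int N m y" for x y
  proof (rule C01_eqI)
    fix r :: real assume r: "r \<in> {0..1}"
    have "integral {r..1} (\<lambda>s. m s * avg N (val (x - y)) s) =
        integral {r..1} (\<lambda>s. m s * avg N (val x) s - m s * avg N (val y) s)"
      by (rule integral_cong)
        (use r in \<open>simp add: avg_val_diff right_diff_distrib\<close>)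
    also have "\<dots> = integral {r..1} (\<lambda>s. m s * avg N (val x) s) - integral {r..1} (\<lambda>s. m s * avg N (val y) s)"
      by (intro integral_diff tail_integrable continuous_intros m r)
    finally show "val (avg_int N m (x - y)) r = val (avg_int N m x - avg_int N m y) r"
      using r by (simp add: val_avg_int m)
  qed
  show scale: "avg_int N m (c *\<^sub>R x) = c *\<^sub>R avg_int N m x" for c x
  proof (rule C01_eqI)
    fix r :: real assume r: "r \<in> {0..1}"
    have "integral {r..1} (\<lambda>s. m s * avg N (val (c *\<^sub>R x)) s) =
        integral {r..1} (\<lambda>s. c * (m s * avg N (val x) s))"
      by (simp add: avg_val_scaleR algebra_simps)
    then show "val (avg_int N m (c *\<^sub>R x)) r = val (c *\<^sub>R avg_int N m x) r"
      using r by (simp add: val_avg_int m)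
  qed
  show "avg_int N m (x + y) = avg_int N m x + avg_int N m y" for x y
    using diff[of x "(-1) *\<^sub>R y"] scale[of "-1" y] by simp
qed

lemma norm_avg_int_le:
  assumes "continuous_on {0..1} m" "\<And>s. s \<in> {0..1} \<Longrightarrow> \<bar>m s\<bar> \<le> B"
  shows "norm (avg_int N m k) \<le> B * norm k"
proof (rule norm_C01_le)
  fix r :: real assume r: "r \<in> {0..1}"
  have "\<bar>integral {r..1} (\<lambda>s. m s * avg N (val k) s)\<bar> \<le> B * norm k"
  proof (rule abs_tail_integral_le[OF _ r])
    show "continuous_on {0..1} (\<lambda>s. m s * avg N (val k) s)"
      by (intro continuous_intros assms(1))
    fix s :: real assume s: "s \<in> {0..1}"
    have "\<bar>avg N (val k) s\<bar> \<le> norm k"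
      by (rule abs_avg_val_le[OF s])
    then show "\<bar>m s * avg N (val k) s\<bar> \<le> B * norm k"
      unfolding abs_mult using assms(2)[OF s] order_trans[OF abs_ge_zero assms(2)[OF s]]
      by (intro mult_mono) auto
  qed
  then show "\<bar>val (avg_int N m k) r\<bar> \<le> B * norm k"
    by (simp only: val_avg_int[OF assms(1) r])
qed

text \<open>Since \<open>p / (p - 1) - 1 = 1 / (p - 1)\<close>, the function
  \<open>phi (p / (p - 1))\<close> is this power on nonnegative arguments, and the power of
  \<open>s * avg N (val h) s\<close> splits into a product.\<close>

lemma val_S_p_avg:
  assumes "p > 1" "N \<ge> 1" "r \<in> {0..1}" "\<And>s. s \<in> {0..1} \<Longrightarrow> avg N (val h) s \<ge> 0"
  shows "val (S_p p N h) r =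
    integral {r..1} (\<lambda>s. s powr (1 / (p - 1)) * avg N (val h) s powr (1 / (p - 1)))"
proof -
  have p: "p / (p - 1) - 1 = 1 / (p - 1)"
    using assms(1) by (simp add: field_simps)
  show ?thesis
    unfolding val_S_p[OF assms(1,3)]
  proof (rule integral_cong)
    fix s assume "s \<in> {r..1}"
    then have s: "s \<in> {0..1}" using assms(3) by auto
    have "s * avg N (val h) s \<ge> 0"
      using s assms(4)[OF s] by simp
    then show "phi (p / (p - 1)) (integral {0..s} (\<lambda>t. (t / s) ^ (N - 1) * val h t)) =
        s powr (1 / (p - 1)) * avg N (val h) s powr (1 / (p - 1))"
      using s assms(4)[OF s] unfolding integral_ratio_eq_avg[OF continuous_on_val s assms(2)]
      by (simp only: phi_nonneg p powr_mult)
  qed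
qed

text \<open>The derivative of the power is uniformly continuous on compact intervals away from
  \<open>0\<close>, so one \<delta> serves all base points \<open>z\<close>. Later \<open>z\<close>
  runs through the values of an average.\<close>

lemma powr_strict_derivative:
  fixes a b \<alpha> \<eta> :: real
  assumes "a > 0" "\<eta> > 0"
  shows "\<exists>\<delta>>0. \<delta> \<le> a / 2 \<and> (\<forall>x y z. z \<in> {a..b} \<longrightarrow> \<bar>x - z\<bar> < \<delta> \<longrightarrow> \<bar>y - z\<bar> < \<delta> \<longrightarrow>
    \<bar>x powr \<alpha> - y powr \<alpha> - \<alpha> * z powr (\<alpha> - 1) * (x - y)\<bar> \<le> \<eta> * \<bar>x - y\<bar>)"
proof -
  let ?D = "\<lambda>z. \<alpha> * z powr (\<alpha> - 1)"
  \<comment> \<open>Widening by \<open>a/2\<close> leaves room for points within \<delta> of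
    \<open>z\<close> while staying away from the singularity at \<open>0\<close>.\<close>
  have "continuous_on {a/2..b + a/2} ?D"
    using assms by (intro continuous_intros) auto
  then have "uniformly_continuous_on {a/2..b + a/2} ?D"
    by (rule compact_uniformly_continuous) simp
  then obtain d where d: "d > 0"
    "\<And>x z. x \<in> {a/2..b + a/2} \<Longrightarrow> z \<in> {a/2..b + a/2} \<Longrightarrow> dist x z < d \<Longrightarrow> dist (?D x) (?D z) < \<eta>"
    using \<open>\<eta> > 0\<close> by (rule uniformly_continuous_onE) (simp add: dist_commute)
  define \<delta> where "\<delta> = min d (a/2)"
  have \<delta>: "\<delta> > 0" "\<delta> \<le> d" "\<delta> \<le> a/2"
    using d(1) \<open>a > 0\<close> by (auto simp: \<delta>_def)
  have est: "\<bar>x powr \<alpha> - y powr \<alpha> - ?D z * (x - y)\<bar> \<le> \<eta> * \<bar>x - y\<bar>"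
    if z: "z \<in> {a..b}" and x: "\<bar>x - z\<bar> < \<delta>" and y: "\<bar>y - z\<bar> < \<delta>" for x y z
  proof (rule mean_value_bound[where S = "ball z \<delta>" and g' = ?D])
    fix w assume w: "w \<in> ball z \<delta>"
    then have w': "\<bar>w - z\<bar> < \<delta>" by (simp add: dist_real_def abs_minus_commute)
    then have "w \<ge> a / 2" "w \<le> b + a / 2" using z \<delta> by auto
    then show "((\<lambda>x. x powr \<alpha>) has_real_derivative ?D w) (at w)"
      using assms by (intro has_real_derivative_powr) auto
    show "\<bar>?D w - ?D z\<bar> \<le> \<eta>"
      by (rule less_imp_le, rule d(2)[unfolded dist_real_def])
        (use w' \<delta>(2) z \<open>w \<ge> a / 2\<close> \<open>w \<le> b + a / 2\<close> \<open>a > 0\<close> in auto)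
  qed (use x y in \<open>auto simp: dist_real_def abs_minus_commute\<close>)
  show ?thesis
    by (intro exI[of _ \<delta>] conjI allI impI \<delta> est)
qed

text \<open>With \<open>H s = s * avg N h s\<close> for the inner integral of \<^const>\<open>S_p\<close>, the non-smoothness of
  \<open>\<xi> \<mapsto> \<xi> powr (1 / (p - 1))\<close> at \<open>0\<close> is confined to the factor \<open>s powr (1 / (p - 1))\<close>, which does
  not depend on \<open>h\<close>.\<close>

lemma S_p_strict_derivative:
  fixes p \<alpha> :: real and h0 :: C01
  assumes p: "p > 1" and N: "N \<ge> 1" and \<alpha>: "\<alpha> = 1 / (p - 1)"
    and pos: "\<And>s. s \<in> {0..1} \<Longrightarrow> avg N (val h0) s > 0" and "\<eta> > 0"
  shows "\<exists>\<delta>>0. \<forall>h k. norm (h - h0) < \<delta> \<longrightarrow> norm (k - h0) < \<delta> \<longrightarrow>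
    norm (S_p p N h - S_p p N k -
      avg_int N (\<lambda>s. \<alpha> * s powr \<alpha> * avg N (val h0) s powr (\<alpha> - 1)) (h - k)) \<le> \<eta> * norm (h - k)"
proof -
  define w0 where "w0 = avg N (val h0)"
  have w0: "continuous_on {0..1} w0"
    unfolding w0_def by (intro continuous_intros)
  have \<alpha>_pos: "\<alpha> > 0" using p \<alpha> by simp
  \<comment> \<open>The extrema of \<open>w0\<close> bound the compact interval of base points for
    the estimate on powers.\<close>
  have "\<exists>x\<in>{0..1}. \<forall>s\<in>{0..1}. w0 x \<le> w0 s" "\<exists>x\<in>{0..1}. \<forall>s\<in>{0..1}. w0 s \<le> w0 x"
    by (rule continuous_attains_inf[OF compact_Icc _ w0], simp)
      (rule continuous_attains_sup[OF compact_Icc _ w0], simp)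
  then obtain x0 x1 where x0: "x0 \<in> {0..1}" "\<And>s. s \<in> {0..1} \<Longrightarrow> w0 x0 \<le> w0 s"
    and x1: "x1 \<in> {0..1}" "\<And>s. s \<in> {0..1} \<Longrightarrow> w0 s \<le> w0 x1"
    by (elim bexE) simp
  have a: "w0 x0 > 0"
    using pos x0 by (simp add: w0_def)
  obtain \<delta> where \<delta>: "\<delta> > 0" "\<delta> \<le> w0 x0 / 2"
    and est: "\<And>x y z. z \<in> {w0 x0..w0 x1} \<Longrightarrow> \<bar>x - z\<bar> < \<delta> \<Longrightarrow> \<bar>y - z\<bar> < \<delta> \<Longrightarrow>
      \<bar>x powr \<alpha> - y powr \<alpha> - \<alpha> * z powr (\<alpha> - 1) * (x - y)\<bar> \<le> \<eta> * \<bar>x - y\<bar>"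
    using powr_strict_derivative[OF a \<open>\<eta> > 0\<close>, of "w0 x1" \<alpha>] by (elim exE conjE) simp
  have avg_le: "\<bar>avg N (val h) s - avg N (val k) s\<bar> \<le> norm (h - k)" if "s \<in> {0..1}" for h k s
    unfolding avg_val_diff[OF that, symmetric] by (rule abs_avg_val_le[OF that])
  \<comment> \<open>\<delta> is at most half the minimum of \<open>w0\<close>, and averages change
    by at most the norm of the difference of the functions.\<close>
  have nonneg: "avg N (val h) s \<ge> 0" if "s \<in> {0..1}" "norm (h - h0) < \<delta>" for h s
    using avg_le[OF that(1), of h h0] x0(2)[OF that(1)] that(2) \<delta> a by (simp add: w0_def)
  let ?m = "\<lambda>s. \<alpha> * s powr \<alpha> * avg N (val h0) s powr (\<alpha> - 1)"
  have powr_cont: "continuous_on {0..1} (\<lambda>s. s powr \<alpha>)"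
    by (intro continuous_on_powr_nonneg \<alpha>_pos continuous_intros) auto
  have m: "continuous_on {0..1} ?m"
    by (intro continuous_on_mult continuous_on_const powr_cont continuous_on_powr continuous_on_avg_val)
      (use pos[THEN less_imp_neq] in auto)
  have Sp_cont: "continuous_on {0..1} (\<lambda>s. s powr \<alpha> * avg N (val h) s powr \<alpha>)"
    if "norm (h - h0) < \<delta>" for h
    by (intro continuous_on_mult powr_cont continuous_on_powr_nonneg \<alpha>_pos continuous_on_avg_val)
      (use nonneg that in auto)
  have est: "norm (S_p p N h - S_p p N k - avg_int N ?m (h - k)) \<le> \<eta> * norm (h - k)"
    if h: "norm (h - h0) < \<delta>" and k: "norm (k - h0) < \<delta>" for h k
  proof (rule norm_C01_le)
    fix r :: real assume r: "r \<in> {0..1}"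
    let ?A = "\<lambda>s. s powr \<alpha> * avg N (val h) s powr \<alpha>" and ?B = "\<lambda>s. s powr \<alpha> * avg N (val k) s powr \<alpha>"
      and ?C = "\<lambda>s. ?m s * avg N (val (h - k)) s"
    have C: "continuous_on {0..1} ?C"
      by (intro continuous_on_mult m continuous_on_avg_val)
    have "val (S_p p N h - S_p p N k - avg_int N ?m (h - k)) r =
        integral {r..1} ?A - integral {r..1} ?B - integral {r..1} ?C"
      using val_S_p_avg[OF p N r nonneg[OF _ h]] val_S_p_avg[OF p N r nonneg[OF _ k]]
        val_avg_int[OF m r] by (simp only: val_diff \<alpha>)
    also have "\<dots> = integral {r..1} (\<lambda>s. ?A s - ?B s - ?C s)"
      unfolding integral_diff[OF integrable_diff[OF tail_integrable[OF Sp_cont[OF h] r]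
        tail_integrable[OF Sp_cont[OF k] r]] tail_integrable[OF C r]]
        integral_diff[OF tail_integrable[OF Sp_cont[OF h] r] tail_integrable[OF Sp_cont[OF k] r]] ..
    also have "\<bar>\<dots>\<bar> \<le> \<eta> * norm (h - k)"
    proof (rule abs_tail_integral_le[OF _ r])
      show "continuous_on {0..1} (\<lambda>s. ?A s - ?B s - ?C s)"
        by (intro continuous_on_diff Sp_cont h k C)
      fix s :: real assume s: "s \<in> {0..1}"
      let ?x = "avg N (val h) s" and ?y = "avg N (val k) s"
      have "?A s - ?B s - ?C s =
          s powr \<alpha> * (?x powr \<alpha> - ?y powr \<alpha> - \<alpha> * w0 s powr (\<alpha> - 1) * (?x - ?y))"
        by (simp add: w0_def algebra_simps avg_val_diff[OF s])
      also have "\<bar>\<dots>\<bar> \<le> 1 * (\<eta> * norm (h - k))"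
        unfolding abs_mult
      proof (rule mult_mono)
        show "\<bar>s powr \<alpha>\<bar> \<le> 1"
          using s \<alpha>_pos powr_mono2[of \<alpha> s 1] by simp
        have "\<bar>?x powr \<alpha> - ?y powr \<alpha> - \<alpha> * w0 s powr (\<alpha> - 1) * (?x - ?y)\<bar> \<le> \<eta> * \<bar>?x - ?y\<bar>"
        proof (rule est)
          show "w0 s \<in> {w0 x0..w0 x1}"
            using x0(2)[OF s] x1(2)[OF s] by simp
          show "\<bar>?x - w0 s\<bar> < \<delta>" "\<bar>?y - w0 s\<bar> < \<delta>"
            unfolding w0_def using avg_le[OF s, of h h0] avg_le[OF s, of k h0] h k by linarith+
        qed
        also have "\<dots> \<le> \<eta> * norm (h - k)"
          using avg_le[OF s] \<open>\<eta> > 0\<close> by (intro mult_left_mono) auto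
        finally show "\<bar>?x powr \<alpha> - ?y powr \<alpha> - \<alpha> * w0 s powr (\<alpha> - 1) * (?x - ?y)\<bar> \<le> \<eta> * norm (h - k)" .
      qed auto
      finally show "\<bar>?A s - ?B s - ?C s\<bar> \<le> \<eta> * norm (h - k)" by simp
    qed
    finally show "\<bar>val (S_p p N h - S_p p N k - avg_int N ?m (h - k)) r\<bar> \<le> \<eta> * norm (h - k)" .
  qed
  show ?thesis
    by (intro exI[of _ \<delta>] conjI allI impI \<delta>(1) est)
qed

section \<open>The nonlinearity after rescaling\<close>

text \<open>At \<open>\<xi> = 0\<close> a quotient with vanishing denominator has the default value
  \<open>0\<close>; it is replaced by the limit profile \<open>k0\<close>.\<close>

definition extend_at_0 :: "(real \<Rightarrow> real) \<Rightarrow> (real \<Rightarrow> real \<Rightarrow> real) \<Rightarrow> real \<Rightarrow> real \<Rightarrow> real"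
  where "extend_at_0 k0 k r \<xi> = (if \<xi> = 0 then k0 r else k r \<xi>)"

text \<open>Away from \<open>\<xi> = 0\<close> the function agrees locally with \<open>k\<close>. At
  \<open>(r0, 0)\<close> the convergence is uniform in \<open>r\<close>, so the error is bounded by
  the sup-norm distance plus the oscillation of \<open>k0\<close> at \<open>r0\<close>.\<close>

lemma continuous_on_extend_at_0:
  fixes k :: "real \<Rightarrow> real \<Rightarrow> real" and k0 :: C01
  assumes k: "continuous_on ({0..1} \<times> - {0}) (\<lambda>(r, \<xi>). k r \<xi>)"
    and lim: "((\<lambda>\<xi>. norm (restr01 (\<lambda>r. k r \<xi>) - k0)) \<longlongrightarrow> 0) (at 0)"
  shows "continuous_on ({0..1} \<times> UNIV) (\<lambda>(r, \<xi>). extend_at_0 (val k0) k r \<xi>)"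
    (is "continuous_on _ ?g")
proof -
  have slice: "continuous_on {0..1} (\<lambda>r. k r \<xi>)" if "\<xi> \<noteq> 0" for \<xi>
  proof -
    have "continuous_on {0..1} (\<lambda>r. case (r, \<xi>) of (r, \<xi>) \<Rightarrow> k r \<xi>)"
      by (rule continuous_on_compose2[OF k]) (use that in \<open>auto intro!: continuous_intros\<close>)
    then show ?thesis by simp
  qed
  have "continuous (at (r0, \<xi>0) within {0..1} \<times> UNIV) ?g" if r0: "r0 \<in> {0..1}" for r0 \<xi>0
  proof (cases "\<xi>0 = 0")
    case False
    have "((\<lambda>(r, \<xi>). k r \<xi>) \<longlongrightarrow> k r0 \<xi>0) (at (r0, \<xi>0) within {0..1} \<times> - {0})"
      using k r0 False by (auto simp: continuous_on_def)
    also have "{0..1} \<times> - {0} = ({0..1} \<times> UNIV) \<inter> (UNIV \<times> - {0::real})"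
      by auto
    also have "at (r0, \<xi>0) within ({0..1} \<times> UNIV) \<inter> (UNIV \<times> - {0}) = at (r0, \<xi>0) within {0..1} \<times> UNIV"
      using False by (intro at_within_nhd[where S = "UNIV \<times> - {0}"] open_Times) auto
    finally have lim': "((\<lambda>(r, \<xi>). k r \<xi>) \<longlongrightarrow> k r0 \<xi>0) (at (r0, \<xi>0) within {0..1} \<times> UNIV)" .
    have "\<forall>\<^sub>F x in at (r0, \<xi>0) within {0..1} \<times> UNIV. x \<in> UNIV \<times> - {0}"
      using False by (intro eventually_at_topological[THEN iffD2] exI[of _ "UNIV \<times> - {0}"])
        (auto intro!: open_Times)
    then have "\<forall>\<^sub>F x in at (r0, \<xi>0) within {0..1} \<times> UNIV. (case x of (r, \<xi>) \<Rightarrow> k r \<xi>) = ?g x"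
      by eventually_elim (auto simp: extend_at_0_def split: if_splits)
    with lim' have "(?g \<longlongrightarrow> k r0 \<xi>0) (at (r0, \<xi>0) within {0..1} \<times> UNIV)"
      by (rule Lim_transform_eventually)
    then show ?thesis
      using False by (simp add: continuous_within extend_at_0_def)
  next
    case True
    \<comment> \<open>The limit hypothesis says nothing about \<open>\<xi> = 0\<close> itself, yet
      points with second component \<open>0\<close> occur in this filter. The indicator factor
      discards the value of \<open>k\<close> there.\<close>
    have "((\<lambda>x. norm (restr01 (\<lambda>r. k r (snd x)) - k0) * (if snd x = 0 then 0 else 1) + \<bar>val k0 (fst x) - val k0 r0\<bar>)
        \<longlongrightarrow> 0 + 0) (at (r0, 0) within {0..1} \<times> UNIV)"
    proof (rule tendsto_add)
      let ?j = "\<lambda>\<xi>. norm (restr01 (\<lambda>r. k r \<xi>) - k0) * (if \<xi> = 0 then 0 else 1)"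
      have "(?j \<longlongrightarrow> 0) (at 0)"
        by (rule Lim_transform_eventually[OF lim]) (auto simp: eventually_at_filter)
      then have lim0: "(?j \<longlongrightarrow> 0) (nhds 0)"
        using tendsto_at_iff_tendsto_nhds[of ?j 0] by simp
      show "((\<lambda>x. norm (restr01 (\<lambda>r. k r (snd x)) - k0) * (if snd x = 0 then 0 else 1))
          \<longlongrightarrow> 0) (at (r0, 0) within {0..1} \<times> UNIV)"
        by (rule filterlim_compose[OF lim0]) (auto intro!: tendsto_eq_intros)
      have "continuous_on UNIV (\<lambda>x::real\<times>real. val k0 (fst x))"
        by (rule continuous_on_compose2[OF continuous_on_val[of UNIV]]) (auto intro!: continuous_intros)
      then have "isCont (\<lambda>x::real\<times>real. val k0 (fst x)) (r0, 0)"
        by (simp add: continuous_on_eq_continuous_at)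
      then have "((\<lambda>x. val k0 (fst x)) \<longlongrightarrow> val k0 r0) (at (r0, 0 :: real))"
        by (simp add: isCont_def)
      then have "((\<lambda>x. val k0 (fst x)) \<longlongrightarrow> val k0 r0) (at (r0, 0 :: real) within {0..1} \<times> UNIV)"
        by (rule tendsto_within_subset) simp
      from tendsto_rabs_zero[OF LIM_zero[OF this]]
      show "((\<lambda>x. \<bar>val k0 (fst x) - val k0 r0\<bar>) \<longlongrightarrow> 0) (at (r0, 0::real) within {0..1} \<times> UNIV)"
.
    qed
    then have "((\<lambda>x. norm (restr01 (\<lambda>r. k r (snd x)) - k0) * (if snd x = 0 then 0 else 1) + \<bar>val k0 (fst x) - val k0 r0\<bar>)
        \<longlongrightarrow> 0) (at (r0, 0) within {0..1} \<times> UNIV)" by simp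
    then have "((\<lambda>x. ?g x - val k0 r0) \<longlongrightarrow> 0) (at (r0, 0) within {0..1} \<times> UNIV)"
    proof (rule Lim_null_comparison[rotated])
      have "norm (?g x - val k0 r0) \<le> norm (restr01 (\<lambda>r. k r (snd x)) - k0) * (if snd x = 0 then 0 else 1)
          + \<bar>val k0 (fst x) - val k0 r0\<bar>" if "x \<in> {0..1} \<times> UNIV" for x
      proof (cases "snd x = 0")
        case False
        have "\<bar>k (fst x) (snd x) - val k0 (fst x)\<bar> \<le> norm (restr01 (\<lambda>r. k r (snd x)) - k0)"
          using abs_val_le_norm[of "restr01 (\<lambda>r. k r (snd x)) - k0" "fst x"]
            val_restr01[OF slice[OF False], of "fst x"] that by auto
        then show ?thesis
          using False by (simp add: extend_at_0_def case_prod_unfold)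
      qed (simp add: extend_at_0_def case_prod_unfold)
      then show "\<forall>\<^sub>F x in at (r0, 0) within {0..1} \<times> UNIV. norm (?g x - val k0 r0)
          \<le> norm (restr01 (\<lambda>r. k r (snd x)) - k0) * (if snd x = 0 then 0 else 1) + \<bar>val k0 (fst x) - val k0 r0\<bar>"
        by (simp add: eventually_at_filter)
    qed
    then have "(?g \<longlongrightarrow> val k0 r0) (at (r0, 0) within {0..1} \<times> UNIV)"
      by (rule LIM_zero_cancel)
    then show ?thesis
      using True by (simp add: continuous_within extend_at_0_def)
  qed
  then show ?thesis
    by (auto simp: continuous_on_eq_continuous_within)
qed

lemma phi_mult: "phi q (x * y) = phi q x * phi q y"
  by (simp add: phi_def abs_mult powr_mult)

lemma phi_eq_0_iff [simp]: "phi q x = 0 \<longleftrightarrow> x = 0"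
  by (auto simp: phi_def)

text \<open>At \<open>0\<close> the difference quotient is
  \<open>\<bar>h\<bar> powr (q - 2)\<close>, which tends to \<open>0\<close> because
  \<open>q > 2\<close>; for negative \<open>x\<close>, oddness reduces the claim to powers of
  \<open>- x\<close>.\<close>

lemma has_real_derivative_phi:
  assumes "q > 2"
  shows "(phi q has_real_derivative (q - 1) * \<bar>x\<bar> powr (q - 2)) (at x)"
proof (cases x "0 :: real" rule: linorder_cases)
  case equal
  have "((\<lambda>h::real. \<bar>h\<bar> powr (q - 2)) \<longlongrightarrow> \<bar>0\<bar> powr (q - 2)) (at 0)"
    using assms by (intro tendsto_powr' tendsto_intros) auto
  then have "((\<lambda>h::real. \<bar>h\<bar> powr (q - 2)) \<longlongrightarrow> 0) (at 0)"
    by simp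
  then have "((\<lambda>h. (phi q (0 + h) - phi q 0) / h) \<longlongrightarrow> 0) (at 0)"
    by (rule Lim_transform_eventually) (auto simp: eventually_at_filter phi_def)
  then show ?thesis
    using equal assms by (simp add: DERIV_def)
next
  case greater
  have "((\<lambda>x. x powr (q - 1)) has_real_derivative (q - 1) * x powr (q - 1 - 1)) (at x)"
    by (rule has_real_derivative_powr[OF greater])
  then have "(phi q has_real_derivative (q - 1) * x powr (q - 1 - 1)) (at x)"
    by (rule has_field_derivative_transform_within_open[where S = "{0<..}"])
      (use greater in \<open>auto simp: phi_nonneg\<close>)
  then show ?thesis using greater by simp
next
  case less
  have "((\<lambda>x. - ((- x) powr (q - 1))) has_real_derivative (q - 1) * (- x) powr (q - 1 - 1)) (at x)"
    using less by (auto intro!: derivative_eq_intros)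
  then have "(phi q has_real_derivative (q - 1) * (- x) powr (q - 1 - 1)) (at x)"
  proof (rule has_field_derivative_transform_within_open[where S = "{..<0}"])
    fix y :: real assume "y \<in> {..<0}"
    then show "- ((- y) powr (q - 1)) = phi q y"
      using phi_nonneg[of "- y" q] by (simp add: phi_minus)
  qed (use less in auto)
  then show ?thesis using less by simp
qed

locale p_homogeneous_at_0 =
  fixes p :: real and f :: "real \<Rightarrow> real \<Rightarrow> real" and f0 :: C01
  assumes p: "p > 2"
    and f_cont: "continuous_on ({0..} \<times> UNIV) (\<lambda>(r, \<xi>). f r \<xi>)"
    and f_0: "\<forall>r\<in>{0..1}. f r 0 = 0"
    and H1: "H1 f" and H4: "H4 p f f0" and H4_left: "H4_left p f f0"
begin

definition F :: "real \<Rightarrow> real \<Rightarrow> real \<Rightarrow> real"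
  where "F r s x = extend_at_0 (val f0) (\<lambda>r \<xi>. f r \<xi> / phi p \<xi>) r (s * x) * phi p x"

definition F' :: "real \<Rightarrow> real \<Rightarrow> real \<Rightarrow> real"
  where "F' r s x = extend_at_0 (val ((p - 1) *\<^sub>R f0)) (\<lambda>r \<xi>. d2 f r \<xi> / \<bar>\<xi>\<bar> powr (p - 2)) r (s * x)
    * \<bar>x\<bar> powr (p - 2)"

text \<open>For \<open>s \<noteq> 0\<close> one has \<open>F r s x = f r (s * x) / phi p s\<close>, and \<open>F'\<close> is the derivative of \<open>F\<close> in \<open>x\<close>;
  in the form chosen here both are visibly continuous up to \<open>s = 0\<close>.\<close>

lemma d2_cont: "continuous_on ({0..1} \<times> UNIV) (\<lambda>(r, \<xi>). d2 f r \<xi>)"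
  using H1 by (simp add: H1_def)

text \<open>Two-sided limits are required even for \<open>s > 0\<close>: since \<open>v0\<close>
  vanishes at \<open>1\<close>, the sum \<open>v0 + z\<close> may be negative near \<open>1\<close>
  for arbitrarily small \<open>z\<close>.\<close>

lemma quotient_limits:
  "((\<lambda>\<xi>. norm (restr01 (\<lambda>r. f r \<xi> / phi p \<xi>) - f0)) \<longlongrightarrow> 0) (at 0)"
  "((\<lambda>\<xi>. norm (restr01 (\<lambda>r. d2 f r \<xi> / \<bar>\<xi>\<bar> powr (p - 2)) - (p - 1) *\<^sub>R f0)) \<longlongrightarrow> 0) (at 0)"
proof -
  show "((\<lambda>\<xi>. norm (restr01 (\<lambda>r. f r \<xi> / phi p \<xi>) - f0)) \<longlongrightarrow> 0) (at 0)"
    using H4 H4_left by (auto simp: H4_def H4_left_def intro: filterlim_split_at)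
  have "((\<lambda>\<xi>. norm (restr01 (\<lambda>r. d2 f r \<xi> / \<xi> powr (p - 2)) - (p - 1) *\<^sub>R f0)) \<longlongrightarrow> 0) (at_right 0)"
    using H4 by (simp add: H4_def)
  then have "((\<lambda>\<xi>. norm (restr01 (\<lambda>r. d2 f r \<xi> / \<bar>\<xi>\<bar> powr (p - 2)) - (p - 1) *\<^sub>R f0)) \<longlongrightarrow> 0) (at_right 0)"
    by (rule Lim_transform_eventually) (auto simp: eventually_at_filter)
  then show "((\<lambda>\<xi>. norm (restr01 (\<lambda>r. d2 f r \<xi> / \<bar>\<xi>\<bar> powr (p - 2)) - (p - 1) *\<^sub>R f0)) \<longlongrightarrow> 0) (at 0)"
    using H4_left by (auto simp: H4_left_def intro: filterlim_split_at)
qed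

lemma continuous_on_F: "continuous_on ({0..1} \<times> UNIV) (\<lambda>(r, s, x). F r s x)"
proof -
  have "continuous_on ({0..1} \<times> - {0}) (\<lambda>(r, \<xi>). f r \<xi> / phi p \<xi>)"
    unfolding case_prod_unfold
    by (intro continuous_on_divide continuous_on_phi continuous_intros
        continuous_on_subset[OF f_cont[unfolded case_prod_unfold]]) (use p in auto)
  from continuous_on_extend_at_0[OF this quotient_limits(1)]
  have g: "continuous_on ({0..1} \<times> UNIV)
      (\<lambda>x. extend_at_0 (val f0) (\<lambda>r \<xi>. f r \<xi> / phi p \<xi>) (fst x) (snd x))"
    by (simp add: case_prod_unfold)
  have "continuous_on ({0..1} \<times> UNIV) (\<lambda>(r, s, x :: real).
      extend_at_0 (val f0) (\<lambda>r \<xi>. f r \<xi> / phi p \<xi>) (fst (r, s * x)) (snd (r, s * x)) * phi p x)"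
    unfolding case_prod_unfold
    by (intro continuous_on_mult continuous_on_phi continuous_on_compose2[OF g])
      (use p in \<open>auto intro!: continuous_intros\<close>)
  then show ?thesis by (simp add: F_def)
qed

lemma continuous_on_F': "continuous_on ({0..1} \<times> UNIV) (\<lambda>(r, s, x). F' r s x)"
proof -
  have "continuous_on ({0..1} \<times> - {0}) (\<lambda>(r, \<xi>). d2 f r \<xi> / \<bar>\<xi>\<bar> powr (p - 2))"
    unfolding case_prod_unfold
    by (intro continuous_on_divide continuous_on_powr continuous_intros
        continuous_on_subset[OF d2_cont[unfolded case_prod_unfold]]) auto
  from continuous_on_extend_at_0[OF this quotient_limits(2)]
  have g: "continuous_on ({0..1} \<times> UNIV) (\<lambda>x. extend_at_0 (val ((p - 1) *\<^sub>R f0))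
      (\<lambda>r \<xi>. d2 f r \<xi> / \<bar>\<xi>\<bar> powr (p - 2)) (fst x) (snd x))"
    by (simp add: case_prod_unfold)
  have "continuous_on ({0..1} \<times> UNIV) (\<lambda>(r, s, x :: real).
      extend_at_0 (val ((p - 1) *\<^sub>R f0)) (\<lambda>r \<xi>. d2 f r \<xi> / \<bar>\<xi>\<bar> powr (p - 2)) (fst (r, s * x)) (snd (r, s * x))
      * \<bar>x\<bar> powr (p - 2))"
    unfolding case_prod_unfold
    by (intro continuous_on_mult continuous_on_powr_nonneg continuous_on_compose2[OF g])
      (use p in \<open>auto intro!: continuous_intros\<close>)
  then show ?thesis by (simp add: F'_def)
qed

lemma F_0: "F r 0 x = val f0 r * phi p x"
  by (simp add: F_def extend_at_0_def)

lemma F'_0: "F' r 0 x = (p - 1) * val f0 r * \<bar>x\<bar> powr (p - 2)"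
  by (simp add: F'_def extend_at_0_def)

text \<open>\<open>phi p\<close> is multiplicative, so \<open>phi p x\<close> cancels; for
  \<open>x = 0\<close> both sides vanish because \<open>f r 0 = 0\<close>.\<close>

lemma F_nonzero: "s \<noteq> 0 \<Longrightarrow> r \<in> {0..1} \<Longrightarrow> F r s x = f r (s * x) / phi p s"
  using f_0 by (auto simp: F_def extend_at_0_def phi_mult)

text \<open>Off \<open>0\<close>, \<open>d2 f r\<close> coincides with \<open>F' r 1\<close>, which
  tends to \<open>0\<close> because of its factor \<open>\<bar>x\<bar> powr (p - 2)\<close>. The
  value settles the derivative of \<open>F r s\<close> at \<open>x = 0\<close>, where the quotient
  form of \<open>F'\<close> is an extension.\<close>

lemma d2_0:
  assumes r: "r \<in> {0..1}"
  shows "d2 f r 0 = 0"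
proof -
  have d2r: "continuous_on UNIV (d2 f r)"
    using H1 r by (simp add: H1_def)
  have "(d2 f r \<longlongrightarrow> d2 f r 0) (at 0)"
    using d2r by (simp add: continuous_on_def)
  moreover have "(d2 f r \<longlongrightarrow> 0) (at 0)"
  proof -
    have "continuous_on UNIV (\<lambda>\<xi>. case (r, 1, \<xi>) of (r, s, x) \<Rightarrow> F' r s x)"
      by (rule continuous_on_compose2[OF continuous_on_F']) (use r in \<open>auto intro!: continuous_intros\<close>)
    then have "(F' r 1 \<longlongrightarrow> F' r 1 0) (at 0)"
      by (simp add: continuous_on_def)
    moreover have "F' r 1 0 = 0"
      using p by (simp add: F'_def)
    ultimately have "(F' r 1 \<longlongrightarrow> 0) (at 0)" by simp
    then show ?thesis
      by (rule Lim_transform_eventually) (auto simp: eventually_at_filter F'_def extend_at_0_def)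
  qed
  ultimately show ?thesis
    by (rule LIM_unique)
qed

lemma has_real_derivative_F:
  assumes r: "r \<in> {0..1}"
  shows "(F r s has_real_derivative F' r s x) (at x)"
proof (cases "s = 0")
  case True
  have "((\<lambda>x. val f0 r * phi p x) has_real_derivative val f0 r * ((p - 1) * \<bar>x\<bar> powr (p - 2))) (at x)"
    by (intro DERIV_cmult has_real_derivative_phi p)
  then show ?thesis
    by (simp add: True F_0[abs_def] F'_0 mult_ac)
next
  case False
  have "(f r has_real_derivative d2 f r (s * x)) (at (s * x))"
    using H1 r by (simp add: H1_def d2_def DERIV_deriv_iff_field_differentiable)
  then have "((\<lambda>x. f r (s * x) / phi p s) has_real_derivative d2 f r (s * x) * s / phi p s) (at x)"
    by (intro DERIV_cdivide DERIV_chain2[where f = "f r"]) (auto intro!: derivative_eq_intros)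
  \<comment> \<open>Here \<open>s / phi p s = 1 / \<bar>s\<bar> powr (p - 2)\<close>, so the sign of
    \<open>s\<close> disappears.\<close>
  moreover have "d2 f r (s * x) * s / phi p s = F' r s x"
    using False p d2_0[OF r] by (simp add: F'_def extend_at_0_def phi_def abs_mult powr_mult)
  moreover have "(\<lambda>x. f r (s * x) / phi p s) = F r s"
    using F_nonzero[OF False r] by auto
  ultimately show ?thesis by simp
qed

end

text \<open>Continuity in \<open>(s, \<tau>)\<close> at \<open>(0, 0)\<close> is uniform over the
  compact range of \<open>r\<close>. The pointwise shift \<tau> is later the value of a function
  with small norm.\<close>

lemma uniform_near_zero_shift:
  fixes K :: "real \<Rightarrow> real \<Rightarrow> real \<Rightarrow> real" and u :: C01
  assumes K: "continuous_on ({0..1} \<times> UNIV) (\<lambda>(r, s, x). K r s x)" and "\<eta> > 0"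
  shows "\<exists>\<delta>>0. \<forall>s \<tau> r. \<bar>s\<bar> < \<delta> \<longrightarrow> \<bar>\<tau>\<bar> < \<delta> \<longrightarrow> r \<in> {0..1} \<longrightarrow>
    \<bar>K r s (val u r + \<tau>) - K r 0 (val u r)\<bar> \<le> \<eta>"
proof -
  have cont: "continuous_on (UNIV \<times> {0..1}) (\<lambda>y :: (real \<times> real) \<times> real.
      (\<lambda>(r, s, x). K r s x) (snd y, fst (fst y), val u (snd y) + snd (fst y)))"
    by (intro continuous_on_compose2[OF K] continuous_on_Pair continuous_on_add
        continuous_on_compose2[OF continuous_on_val[of UNIV]] continuous_intros) auto
  obtain X where X: "(0, 0) \<in> X" "open X"
    and X_le: "\<forall>y\<in>X \<inter> UNIV. \<forall>r\<in>{0..1}. dist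
      ((\<lambda>y :: (real \<times> real) \<times> real. (\<lambda>(r, s, x). K r s x) (snd y, fst (fst y), val u (snd y) + snd (fst y))) (y, r))
      ((\<lambda>y :: (real \<times> real) \<times> real. (\<lambda>(r, s, x). K r s x) (snd y, fst (fst y), val u (snd y) + snd (fst y))) ((0, 0), r)) \<le> \<eta>"
    by (rule continuous_on_prod_compactE[OF cont compact_Icc UNIV_I \<open>\<eta> > 0\<close>, of "(0, 0)"])
  obtain e where e: "e > 0" "ball (0, 0) e \<subseteq> X"
    using X openE by blast
  have "\<bar>K r s (val u r + \<tau>) - K r 0 (val u r)\<bar> \<le> \<eta>"
    if "\<bar>s\<bar> < e / 2" "\<bar>\<tau>\<bar> < e / 2" "r \<in> {0..1}" for s \<tau> r
  proof -
    have "dist (0, 0) (s, \<tau>) \<le> \<bar>s\<bar> + \<bar>\<tau>\<bar>"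
      using sqrt_sum_squares_le_sum_abs[of s \<tau>] by (simp add: dist_Pair_Pair)
    then have "(s, \<tau>) \<in> ball (0, 0) e"
      using that by simp
    then have "(s, \<tau>) \<in> X" using e by blast
    then show ?thesis
      using X_le that(3) by (auto simp: dist_real_def)
  qed
  then show ?thesis
    using e(1) by (intro exI[of _ "e / 2"]) auto
qed

section \<open>The linearization at the eigenfunction\<close>

text \<open>The integrand is nonnegative and strictly positive at \<open>t = 1/2\<close>, because
  \<open>s * t < 1\<close> there for every \<open>s\<close> in \<open>[0,1]\<close>, including
  \<open>s = 1\<close>.\<close>

lemma avg_pos:
  assumes h: "continuous_on {0..1} h" and nonneg: "\<And>t. t \<in> {0..1} \<Longrightarrow> h t \<ge> 0"
    and pos: "\<And>t. t \<in> {0..<1} \<Longrightarrow> h t > 0" and s: "s \<in> {0..1}"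
  shows "avg N h s > 0"
proof -
  let ?g = "\<lambda>t. t ^ (N - 1) * h (s * t)"
  have cont: "continuous_on {0..1} ?g"
    by (intro continuous_on_mult continuous_on_power continuous_on_id continuous_on_scaled[OF h s])
  have g: "?g t \<ge> 0" if "t \<in> {0..1}" for t
    using that s by (intro mult_nonneg_nonneg nonneg) (auto simp: mult_le_one)
  have "?g (1/2) > 0"
    using s by (intro mult_pos_pos pos) auto
  moreover have "integral {0..1} ?g = 0 \<Longrightarrow> ?g (1/2) = 0"
    using integral_eq_0_iff[OF cont] g by (auto dest: bspec[of _ _ "1/2"])
  moreover have "integral {0..1} ?g \<ge> 0"
    by (rule integral_nonneg[OF integrable_continuous_real[OF cont] g])
  ultimately show ?thesis
    unfolding avg_def by fastforce
qed

lemma has_real_derivative_integral_power: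
  assumes "continuous_on {0..1} h" "r \<in> {0..1}"
  shows "((\<lambda>r. integral {0..r} (\<lambda>t. t ^ (N - 1) * h t)) has_real_derivative r ^ (N - 1) * h r)
    (at r within {0..1})"
  by (rule integral_has_real_derivative)
    (intro continuous_on_mult continuous_on_power continuous_on_id assms)+

text \<open>The half-open interval is suited to quotients by \<open>v0\<close>, which are
  differentiable only below \<open>1\<close>.\<close>

lemma has_real_derivative_zero_on_half_open:
  fixes g :: "real \<Rightarrow> real"
  assumes "\<And>r. r \<in> {0..<1} \<Longrightarrow> (g has_real_derivative 0) (at r within {0..1})" and "r \<in> {0..<1}"
  shows "g r = g 0"
proof -
  have "\<exists>c. \<forall>x\<in>{0..<1}. g x = c"
  proof (rule has_field_derivative_zero_constant)
    fix x :: real assume "x \<in> {0..<1}"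
    then show "(g has_real_derivative 0) (at x within {0..<1})"
      by (rule has_field_derivative_subset[OF assms(1)]) auto
  qed simp
  then show ?thesis using assms(2) by force
qed

locale radial_eigenpair =
  fixes N :: nat and p lam0 :: real and f0 v0 :: C01
  assumes N: "N \<ge> 1" and p: "p > 2"
    and f0_pos: "\<forall>r\<in>{0..1}. val f0 r > 0"
    and lam0: "lam0 > 0" and eigen: "positive_eigenfunction p N f0 lam0 v0"
    and normalized: "integral {0..1} (\<lambda>r. r ^ (N - 1) * val f0 r * \<bar>val v0 r\<bar> powr p) = 1"
begin

definition \<alpha> :: real where "\<alpha> = 1 / (p - 1)"

definition h0 :: C01 where "h0 = restr01 (\<lambda>r. lam0 * val f0 r * phi p (val v0 r))"

definition w0 :: "real \<Rightarrow> real" where "w0 = avg N (val h0)"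

text \<open>Two roles meet in this weight: \<open>m * w0\<close> is \<open>- v0'\<close>, and
  \<open>\<alpha> * m\<close> is the weight in the derivative of \<open>S_p\<close> at
  \<open>h0\<close>.\<close>

definition m :: "real \<Rightarrow> real" where "m s = s powr \<alpha> * w0 s powr (\<alpha> - 1)"

text \<open>The derivative of \<open>val f0 r * phi p x\<close> at \<open>x = val v0 r\<close> is
  \<open>(p - 1) * \<beta> r\<close>, while \<open>\<beta> * v0\<close> is the nonlinearity itself.
  So the nonlinear equation for \<open>v0\<close> is also a linear one with weight \<beta>.\<close>

definition \<beta> :: "real \<Rightarrow> real" where "\<beta> r = val f0 r * \<bar>val v0 r\<bar> powr (p - 2)"

lemma \<alpha>: "\<alpha> > 0" "(p - 1) * \<alpha> = 1"
  using p by (auto simp: \<alpha>_def)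

section \<open>The eigenfunction in integral form\<close>

lemma v_1: "val v0 1 = 0"
  using eigen by (auto simp: positive_eigenfunction_def)

lemma v_pos: "r \<in> {0..<1} \<Longrightarrow> val v0 r > 0"
  using eigen by (auto simp: positive_eigenfunction_def)

lemma v_nonneg: "r \<in> {0..1} \<Longrightarrow> val v0 r \<ge> 0"
  using v_1 v_pos[of r] by (cases "r = 1") auto

lemma continuous_on_\<beta>: "continuous_on {0..1} \<beta>"
  unfolding \<beta>_def[abs_def]
  by (intro continuous_on_mult continuous_on_powr_nonneg continuous_on_rabs continuous_on_val)
    (use p in auto)

lemma \<beta>_v: "\<beta> r * val v0 r = val f0 r * phi p (val v0 r)"
  by (simp add: \<beta>_def phi_def)

lemma val_h0: "r \<in> {0..1} \<Longrightarrow> val h0 r = lam0 * (\<beta> r * val v0 r)"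
  unfolding h0_def
  by (subst val_restr01) (use p in \<open>auto simp: \<beta>_v intro!: continuous_intros\<close>)

lemma avg_\<beta>_v: "s \<in> {0..1} \<Longrightarrow> lam0 * avg N (\<lambda>t. \<beta> t * val v0 t) s = w0 s"
  unfolding w0_def avg_cmult[symmetric] by (rule avg_cong) (simp_all add: val_h0)

lemma w0_pos: "s \<in> {0..1} \<Longrightarrow> w0 s > 0"
  unfolding w0_def
proof (rule avg_pos[OF continuous_on_val])
  fix t :: real
  show "val h0 t \<ge> 0" if "t \<in> {0..1}"
    using that lam0 f0_pos[rule_format, OF that] v_nonneg[OF that] by (simp add: val_h0 \<beta>_def)
  show "val h0 t > 0" if "t \<in> {0..<1}"
    using that lam0 f0_pos v_pos[OF that] by (simp add: val_h0 \<beta>_def)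
qed

lemma continuous_on_w0: "continuous_on {0..1} w0"
  unfolding w0_def by (rule continuous_on_avg_val)

lemma continuous_on_m: "continuous_on {0..1} m"
  unfolding m_def[abs_def]
  by (intro continuous_on_mult continuous_on_powr_nonneg continuous_on_powr continuous_on_w0
      continuous_on_id continuous_on_const \<alpha>) (use w0_pos in force)+

lemma m_pos: "s \<in> {0<..1} \<Longrightarrow> m s > 0"
  using w0_pos[of s] by (simp add: m_def)

lemma m_w0:
  assumes "s \<in> {0..1}"
  shows "m s * w0 s = s powr \<alpha> * w0 s powr \<alpha>"
  using w0_pos[OF assms] by (simp add: m_def powr_diff)

text \<open>Integrating the equation over \<open>[0,r]\<close> and dividing by
  \<open>r ^ (N - 1)\<close> gives \<open>phi p (v' r) = - (r * w0 r)\<close>. Positivity of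
  \<open>w0\<close> fixes the sign of \<open>v' r\<close>, and the power \<alpha> inverts
  \<open>phi p\<close>.\<close>

lemma has_real_derivative_v:
  assumes r: "r \<in> {0..1}"
  shows "(val v0 has_real_derivative - (m r * w0 r)) (at r within {0..1})"
proof -
  obtain v' where v': "continuous_on {0..1} v'" "v' 0 = 0"
    "\<And>r. r \<in> {0..1} \<Longrightarrow> (val v0 has_real_derivative v' r) (at r within {0..1})"
    "\<And>r. r \<in> {0<..<1} \<Longrightarrow> ((\<lambda>r. r ^ (N - 1) * phi p (v' r)) has_real_derivative
        - (lam0 * r ^ (N - 1) * val f0 r * phi p (val v0 r))) (at r)"
    using eigen unfolding positive_eigenfunction_def by blast
  have "v' r = - (m r * w0 r)"
  proof (cases "r = 0")
    case True
    then show ?thesis using v'(2) by (simp add: m_def)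
  next
    case False
    have "((\<lambda>t. - (t ^ (N - 1) * val h0 t)) has_integral
        (r ^ (N - 1) * phi p (v' r) - 0 ^ (N - 1) * phi p (v' 0))) {0..r}"
    proof (rule fundamental_theorem_of_calculus_interior)
      show "continuous_on {0..r} (\<lambda>r. r ^ (N - 1) * phi p (v' r))"
        using p r by (intro continuous_intros continuous_on_subset[OF v'(1)]) auto
      fix t assume "t \<in> {0<..<r}"
      then have t: "t \<in> {0<..<1}" using r by auto
      have "lam0 * t ^ (N - 1) * val f0 t * phi p (val v0 t) = t ^ (N - 1) * val h0 t"
        using val_h0[of t, unfolded \<beta>_v] t by (simp add: mult_ac)
      then show "((\<lambda>r. r ^ (N - 1) * phi p (v' r)) has_vector_derivative - (t ^ (N - 1) * val h0 t)) (at t)"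
        using v'(4)[OF t] by (simp only: has_real_derivative_iff_has_vector_derivative)
    qed (use r in simp)
    \<comment> \<open>For \<open>N = 1\<close> the factor \<open>0 ^ (N - 1)\<close> is
      \<open>1\<close>, and the boundary term vanishes because \<open>v' 0 = 0\<close>.\<close>
    then have "r ^ (N - 1) * phi p (v' r) = integral {0..r} (\<lambda>t. - (t ^ (N - 1) * val h0 t))"
      by (simp only: v'(2) integral_unique phi_0 mult_zero_right diff_zero)
    also have "\<dots> = - (r ^ N * w0 r)"
      unfolding integral_neg integral_power_eq_avg[OF continuous_on_val r N] w0_def ..
    finally have "r ^ (N - 1) * phi p (v' r) = r ^ (N - 1) * (- (r * w0 r))"
      using N by (cases N) (simp_all add: mult_ac)
    then have "phi p (v' r) = - (r * w0 r)"
      using False by (simp only: mult_cancel_left power_eq_0_iff) blast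
    then have "phi p (- v' r) = r * w0 r"
      by (simp add: phi_minus)
    moreover have pos: "r * w0 r > 0"
      using False r w0_pos[OF r] by simp
    ultimately have "- v' r > 0" "\<bar>v' r\<bar> powr (p - 1) = r * w0 r"
      using abs_phi[of p "- v' r"] zero_less_mult_pos[of "\<bar>v' r\<bar> powr (p - 2)" "- v' r"]
      by (auto simp: phi_def split: if_splits)
    then have "- v' r = (r * w0 r) powr \<alpha>"
      using \<alpha> by (simp add: powr_powr flip: \<open>\<bar>v' r\<bar> powr (p - 1) = r * w0 r\<close>)
    then show ?thesis
      using m_w0[OF r] r w0_pos[OF r] by (simp add: powr_mult)
  qed
  then show ?thesis using v'(3)[OF r] by simp
qed

lemma v_eq_integral:
  assumes r: "r \<in> {0..1}"
  shows "val v0 r = integral {r..1} (\<lambda>s. m s * w0 s)"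
proof -
  have "((\<lambda>s. - (m s * w0 s)) has_integral (val v0 1 - val v0 r)) {r..1}"
  proof (rule fundamental_theorem_of_calculus)
    fix s assume "s \<in> {r..1}"
    then have "s \<in> {0..1}" using r by auto
    from has_field_derivative_subset[OF has_real_derivative_v[OF this], of "{r..1}"]
    show "(val v0 has_vector_derivative - (m s * w0 s)) (at s within {r..1})"
      using r by (simp add: has_real_derivative_iff_has_vector_derivative)
  qed (use r in simp)
  from has_integral_neg[OF this] show ?thesis
    by (simp add: v_1 integral_unique)
qed

lemma v_antimono:
  assumes "r \<in> {0..1}" "s \<in> {0..1}" "r \<le> s"
  shows "val v0 s \<le> val v0 r"
proof (rule DERIV_nonpos_imp_decreasing_open[OF \<open>r \<le> s\<close>, of "val v0"])
  fix x assume "r < x" "x < s"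
  then have x: "x \<in> {0<..<1}" using assms by auto
  then have "at x within {0..1} = at x"
    by (intro at_within_interior) simp
  then have "(val v0 has_real_derivative - (m x * w0 x)) (at x)"
    using has_real_derivative_v[of x] x by simp
  moreover have "m x * w0 x \<ge> 0"
    using m_pos[of x] w0_pos[of x] x by simp
  ultimately show "\<exists>y. (val v0 has_real_derivative y) (at x) \<and> y \<le> 0"
    by (intro exI[of _ "- (m x * w0 x)"]) simp
qed (rule continuous_on_val)

text \<open>The slope \<open>- v0' = m * w0\<close> has a positive minimum on
  \<open>[1/2,1]\<close>; the interval starts at \<open>1/2\<close> because \<open>m\<close>
  vanishes at \<open>0\<close>. This controls the degeneracy of \<open>v0\<close> at the
  boundary.\<close>

lemma v_lower_bound: "\<exists>c>0. \<forall>s\<in>{1/2..1}. c * (1 - s) \<le> val v0 s"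
proof -
  have cont: "continuous_on {0..1} (\<lambda>s. m s * w0 s)"
    by (intro continuous_on_mult continuous_on_m continuous_on_w0)
  then have cont': "continuous_on {1/2..1} (\<lambda>s. m s * w0 s)"
    by (rule continuous_on_subset) auto
  have "\<exists>x\<in>{1/2..1}. \<forall>y\<in>{1/2..1}. m x * w0 x \<le> m y * w0 y"
    by (rule continuous_attains_inf[OF compact_Icc _ cont']) simp
  then obtain x where x: "x \<in> {1/2..1}" "\<And>y. y \<in> {1/2..1} \<Longrightarrow> m x * w0 x \<le> m y * w0 y"
    by (elim bexE) simp
  have "m x * w0 x * (1 - s) \<le> val v0 s" if s: "s \<in> {1/2..1}" for s
  proof -
    have "integral {s..1} (\<lambda>_. m x * w0 x) \<le> integral {s..1} (\<lambda>s. m s * w0 s)"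
      by (rule integral_le) (use s x tail_integrable[OF cont, of s] in auto)
    then show ?thesis
      using s v_eq_integral[of s] by (simp add: mult_ac)
  qed
  moreover have "m x * w0 x > 0"
    using x(1) m_pos[of x] w0_pos[of x] by simp
  ultimately show ?thesis by blast
qed

lemma S_p_h0: "S_p p N h0 = v0"
proof (rule C01_eqI)
  fix r :: real assume r: "r \<in> {0..1}"
  have "val (S_p p N h0) r = integral {r..1} (\<lambda>s. s powr (1 / (p - 1)) * avg N (val h0) s powr (1 / (p - 1)))"
    by (rule val_S_p_avg[OF _ N r]) (use p w0_pos in \<open>auto simp: w0_def intro: less_imp_le\<close>)
  also have "\<dots> = integral {r..1} (\<lambda>s. m s * w0 s)"
    by (rule integral_cong) (use r m_w0 in \<open>auto simp: w0_def \<alpha>_def\<close>)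
  finally show "val (S_p p N h0) r = val v0 r"
    by (simp add: v_eq_integral[OF r])
qed

text \<open>This is Euler's relation: \<open>S_p\<close> is positively homogeneous of degree
  \<alpha>, and its derivative at \<open>h0\<close> is \<alpha> times
  \<open>avg_int N m\<close>.\<close>

lemma avg_int_h0: "avg_int N m h0 = v0"
  by (rule C01_eqI) (simp add: val_avg_int[OF continuous_on_m] v_eq_integral flip: w0_def)

section \<open>The weight as an operator and the orthogonality functional\<close>

definition Mult :: "C01 \<Rightarrow> C01" where "Mult z = restr01 (\<lambda>r. \<beta> r * val z r)"

lemma val_Mult: "r \<in> {0..1} \<Longrightarrow> val (Mult z) r = \<beta> r * val z r"
  unfolding Mult_def
  by (rule val_restr01) (intro continuous_on_mult continuous_on_\<beta> continuous_on_val)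

lemma linear_Mult: "linear Mult"
  by (rule linearI; rule C01_eqI) (simp_all add: val_Mult algebra_simps)

text \<open>The kernel of this functional is \<open>Z\<close>, and \<open>ell v0 = 1\<close> makes
  \<open>ell\<close> the coordinate along \<open>v0\<close>. Written as an average at
  \<open>1\<close>, it inherits the estimates for averages.\<close>

definition ell :: "C01 \<Rightarrow> real" where "ell z = avg N (\<lambda>t. \<beta> t * val v0 t * val z t) 1"

lemma continuous_on_\<beta>_v: "continuous_on {0..1} (\<lambda>t. \<beta> t * val v0 t)"
  by (intro continuous_on_mult continuous_on_\<beta> continuous_on_val)

lemma continuous_on_\<beta>_v_z: "continuous_on {0..1} (\<lambda>t. \<beta> t * val v0 t * val z t)"
  by (intro continuous_on_mult continuous_on_\<beta> continuous_on_val)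

lemma \<beta>_v_bound: "\<exists>B>0. \<forall>t\<in>{0..1}. \<bar>\<beta> t * val v0 t\<bar> \<le> B"
proof -
  have "bounded ((\<lambda>t. \<beta> t * val v0 t) ` {0..1})"
    by (intro compact_imp_bounded compact_continuous_image continuous_on_\<beta>_v) simp
  then show ?thesis
    by (auto simp: bounded_pos)
qed

lemma Z_eq: "Z p N f0 v0 = {z. ell z = 0}"
  unfolding Z_def ell_def avg_def \<beta>_def by (simp add: mult.assoc)

lemma ell_v0: "ell v0 = 1"
proof -
  have "ell v0 = integral {0..1} (\<lambda>r. r ^ (N - 1) * val f0 r * \<bar>val v0 r\<bar> powr p)"
    unfolding ell_def avg_def
  proof (rule integral_cong)
    fix t :: real assume "t \<in> {0..1}"
    then have "\<bar>val v0 t\<bar> powr p = \<bar>val v0 t\<bar> powr (p - 2) * val v0 t * val v0 t"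
      using v_nonneg[of t] p powr_add[of "val v0 t" "p - 2" 2] by (simp add: power2_eq_square)
    then show "t ^ (N - 1) * (\<beta> (1 * t) * val v0 (1 * t) * val v0 (1 * t)) =
        t ^ (N - 1) * val f0 t * \<bar>val v0 t\<bar> powr p"
      by (simp add: \<beta>_def)
  qed
  then show ?thesis by (simp only: normalized)
qed

lemma ell_bounded_linear: "bounded_linear ell"
proof -
  obtain B where B: "B > 0" "\<forall>t\<in>{0..1}. \<bar>\<beta> t * val v0 t\<bar> \<le> B"
    using \<beta>_v_bound by blast
  have diff: "ell (x - y) = ell x - ell y" for x y
    using avg_diff[OF continuous_on_\<beta>_v_z[of x] continuous_on_\<beta>_v_z[of y], of 1]
    by (simp add: ell_def avg_def algebra_simps)
  have scale: "ell (c *\<^sub>R x) = c * ell x" for c x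
    unfolding ell_def avg_cmult[symmetric] by (simp add: avg_def algebra_simps)
  show ?thesis
  proof (rule bounded_linear_intro)
    show "ell (x + y) = ell x + ell y" for x y
      using diff[of x "(-1) *\<^sub>R y"] scale[of "-1" y] by simp
    show "ell (c *\<^sub>R x) = c *\<^sub>R ell x" for c x
      by (simp add: scale)
    show "norm (ell x) \<le> norm x * B" for x
      unfolding ell_def real_norm_def
    proof (rule abs_avg_le[OF continuous_on_\<beta>_v_z])
      fix t :: real assume "t \<in> {0..1}"
      then show "\<bar>\<beta> t * val v0 t * val x t\<bar> \<le> norm x * B"
        using B abs_val_le_norm[of x t] mult_mono[of "\<bar>\<beta> t * val v0 t\<bar>" B "\<bar>val x t\<bar>" "norm x"]
        by (simp add: abs_mult mult.commute)
    qed simp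
  qed
qed

text \<open>\<open>u = K z\<close> solves
  \<open>- (r^(N-1) |v0'|^(p-2) u')' = lam0 r^(N-1) \<beta> z\<close> with \<open>u 1 = 0\<close>.
  The flux \<open>r^(N-1) |v0'|^(p-2) u'\<close> is \<open>- lam0\<close> times the integral of
  \<open>t^(N-1) \<beta> z\<close> over \<open>[0,r]\<close>.\<close>

definition K :: "C01 \<Rightarrow> C01" where "K z = lam0 *\<^sub>R avg_int N m (Mult z)"

section \<open>Flux integrals and the Wronskian\<close>

definition I :: "(real \<Rightarrow> real) \<Rightarrow> real \<Rightarrow> real"
  where "I h r = integral {0..r} (\<lambda>t. t ^ (N - 1) * h t)"

lemma I_eq_avg: "continuous_on {0..1} h \<Longrightarrow> r \<in> {0..1} \<Longrightarrow> I h r = r ^ N * avg N h r"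
  unfolding I_def by (rule integral_power_eq_avg[OF _ _ N])

lemma has_real_derivative_I:
  "continuous_on {0..1} h \<Longrightarrow> r \<in> {0..1} \<Longrightarrow> (I h has_real_derivative r ^ (N - 1) * h r) (at r within {0..1})"
  unfolding I_def[abs_def] by (rule has_real_derivative_integral_power)

lemma I_0 [simp]: "I h 0 = 0"
  by (simp add: I_def)

lemma continuous_on_\<beta>_z: "continuous_on {0..1} (\<lambda>t. \<beta> t * val z t)"
  by (intro continuous_on_mult continuous_on_\<beta> continuous_on_val)

lemma avg_Mult: "s \<in> {0..1} \<Longrightarrow> avg N (val (Mult z)) s = avg N (\<lambda>t. \<beta> t * val z t) s"
  by (rule avg_cong) (simp_all add: val_Mult)

lemma val_K:
  assumes "r \<in> {0..1}"
  shows "val (K z) r = integral {r..1} (\<lambda>s. lam0 * (m s * avg N (\<lambda>t. \<beta> t * val z t) s))"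
proof -
  have "integral {r..1} (\<lambda>s. m s * avg N (val (Mult z)) s) =
      integral {r..1} (\<lambda>s. m s * avg N (\<lambda>t. \<beta> t * val z t) s)"
    by (rule integral_cong) (use assms in \<open>simp add: avg_Mult\<close>)
  then show ?thesis
    by (simp add: K_def val_avg_int[OF continuous_on_m assms])
qed

lemma has_real_derivative_K:
  assumes "r \<in> {0..1}"
  shows "(val (K z) has_real_derivative - (lam0 * (m r * avg N (\<lambda>t. \<beta> t * val z t) r))) (at r within {0..1})"
proof -
  have "((\<lambda>r. integral {r..1} (\<lambda>s. lam0 * (m s * avg N (\<lambda>t. \<beta> t * val z t) s))) has_real_derivative
      - (lam0 * (m r * avg N (\<lambda>t. \<beta> t * val z t) r))) (at r within {0..1})"
    by (rule integral_has_real_derivative'[OF _ assms])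
      (intro continuous_on_mult continuous_on_const continuous_on_m continuous_on_avg continuous_on_\<beta>_z)
  then show ?thesis
    by (rule has_field_derivative_transform_within[where d = 1]) (use assms val_K in auto)
qed

lemma K_1: "val (K z) 1 = 0"
  by (simp add: val_K)

lemma has_real_derivative_v':
  "r \<in> {0..1} \<Longrightarrow> (val v0 has_real_derivative - (lam0 * (m r * avg N (\<lambda>t. \<beta> t * val v0 t) r))) (at r within {0..1})"
  using has_real_derivative_v[of r] by (simp add: mult.left_commute[of lam0] avg_\<beta>_v)

text \<open>The expression differentiated here is the Wronskian of \<open>K z\<close> and \<open>v0\<close>.\<close>

lemma wronskian_derivative:
  assumes r: "r \<in> {0..1}"
  shows "((\<lambda>r. I (\<lambda>t. \<beta> t * val v0 t) r * val (K z) r - I (\<lambda>t. \<beta> t * val z t) r * val v0 r)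
    has_real_derivative r ^ (N - 1) * (\<beta> r * val v0 r * (val (K z) r - val z r))) (at r within {0..1})"
proof -
  let ?A = "I (\<lambda>t. \<beta> t * val v0 t) r" and ?B = "I (\<lambda>t. \<beta> t * val z t) r"
  let ?a = "avg N (\<lambda>t. \<beta> t * val v0 t) r" and ?b = "avg N (\<lambda>t. \<beta> t * val z t) r"
  have "((\<lambda>r. I (\<lambda>t. \<beta> t * val v0 t) r * val (K z) r - I (\<lambda>t. \<beta> t * val z t) r * val v0 r)
    has_real_derivative
      (r ^ (N - 1) * (\<beta> r * val v0 r) * val (K z) r + (- (lam0 * (m r * ?b))) * ?A)
      - (r ^ (N - 1) * (\<beta> r * val z r) * val v0 r + (- (lam0 * (m r * ?a))) * ?B)) (at r within {0..1})"
    by (intro DERIV_diff DERIV_mult has_real_derivative_I has_real_derivative_K has_real_derivative_v'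
        continuous_on_\<beta>_z continuous_on_\<beta>_v r)
  \<comment> \<open>With these forms the two terms containing \<open>lam0 * m r\<close> are equal
    and cancel, which expresses the symmetry of the linear problem.\<close>
  moreover have "?A = r ^ N * ?a" "?B = r ^ N * ?b"
    by (simp_all only: I_eq_avg[OF _ r] continuous_on_\<beta>_z continuous_on_\<beta>_v)
  ultimately show ?thesis
    by (simp add: algebra_simps)
qed

text \<open>The integrated Wronskian identity forces \<open>c = 0\<close>. The Wronskian then
  vanishes identically, so \<open>K z / v0\<close> is constant and \<open>z\<close> is a multiple of
  \<open>v0\<close>, which \<open>ell z = 0\<close> rules out unless it is zero.\<close>

lemma linearization_injective:
  assumes ell_z: "ell z = 0" and z: "z = c *\<^sub>R v0 + K z"
  shows "z = 0" "c = 0"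
proof -
  let ?P = "\<lambda>r. I (\<lambda>t. \<beta> t * val v0 t) r * val (K z) r - I (\<lambda>t. \<beta> t * val z t) r * val v0 r"
  have Kz: "val (K z) r - val z r = - c * val v0 r" for r
    using arg_cong[OF z, of "\<lambda>u. val u r"] by simp
  have P': "(?P has_real_derivative - c * (r ^ (N - 1) * (\<beta> r * val v0 r * val v0 r))) (at r within {0..1})"
    if "r \<in> {0..1}" for r
    using wronskian_derivative[OF that, of z] unfolding Kz by (simp add: algebra_simps)
  \<comment> \<open>Both boundary values of \<open>?P\<close> are zero: the flux integrals vanish at
    \<open>0\<close>, and \<open>K z\<close> and \<open>v0\<close> vanish at
    \<open>1\<close>.\<close>
  have "((\<lambda>r. - c * (r ^ (N - 1) * (\<beta> r * val v0 r * val v0 r))) has_integral (?P 1 - ?P 0)) {0..1}"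
    by (rule fundamental_theorem_of_calculus)
      (use P' in \<open>simp_all only: has_real_derivative_iff_has_vector_derivative\<close>)
  then have "integral {0..1} (\<lambda>r. - c * (r ^ (N - 1) * (\<beta> r * val v0 r * val v0 r))) = 0"
    by (simp only: integral_unique K_1 v_1 I_0 mult_zero_left mult_zero_right diff_self)
  then have "- c * ell v0 = 0"
    unfolding integral_mult_right by (simp add: ell_def avg_def)
  then show c: "c = 0"
    by (simp add: ell_v0)
  have P0: "?P r = 0" if r: "r \<in> {0..<1}" for r
  proof -
    have "?P r = ?P 0"
    proof (rule has_real_derivative_zero_on_half_open[OF _ r])
      fix t :: real assume "t \<in> {0..<1}"
      then show "(?P has_real_derivative 0) (at t within {0..1})"
        using P'[of t] c by simp
    qed
    then show ?thesis by simp
  qed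
  have quot: "val (K z) r / val v0 r = val (K z) 0 / val v0 0" if r: "r \<in> {0..<1}" for r
  proof (rule has_real_derivative_zero_on_half_open[OF _ r])
    fix r :: real assume r: "r \<in> {0..<1}"
    then have r': "r \<in> {0..1}" by auto
    let ?a = "avg N (\<lambda>t. \<beta> t * val v0 t) r" and ?b = "avg N (\<lambda>t. \<beta> t * val z t) r"
    \<comment> \<open>The Wronskian carries the factor \<open>r ^ N\<close> and says nothing at
      \<open>r = 0\<close>; there \<open>m 0 = 0\<close> takes over.\<close>
    have "m r * (?b * val v0 r - val (K z) r * ?a) = 0"
    proof (cases "r = 0")
      case False
      have "r ^ N * (val (K z) r * ?a - ?b * val v0 r) = 0"
        using P0[OF r] unfolding I_eq_avg[OF continuous_on_\<beta>_v r'] I_eq_avg[OF continuous_on_\<beta>_z r']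
        by (simp add: algebra_simps)
      then show ?thesis using False by simp
    qed (simp add: m_def)
    then have "lam0 * (m r * (?b * val v0 r - val (K z) r * ?a)) = 0" by simp
    then have num: "- (lam0 * (m r * ?b)) * val v0 r - val (K z) r * - (lam0 * (m r * ?a)) = 0"
      by (auto simp: algebra_simps)
    have "((\<lambda>r. val (K z) r / val v0 r) has_real_derivative
        (- (lam0 * (m r * ?b)) * val v0 r - val (K z) r * - (lam0 * (m r * ?a))) / (val v0 r * val v0 r))
        (at r within {0..1})"
      by (rule DERIV_divide[OF has_real_derivative_K[OF r'] has_real_derivative_v'[OF r']])
        (use v_pos[OF r] in simp)
    then show "((\<lambda>r. val (K z) r / val v0 r) has_real_derivative 0) (at r within {0..1})"
      unfolding num by simp
  qed
  have "z = (val (K z) 0 / val v0 0) *\<^sub>R v0"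
  proof (rule C01_eqI)
    fix r :: real assume r: "r \<in> {0..1}"
    have "val z r = val (K z) r"
      using Kz[of r] c by simp
    also have "\<dots> = (val (K z) 0 / val v0 0) * val v0 r"
    proof (cases "r = 1")
      case True
      then show ?thesis by (simp add: K_1 v_1)
    next
      case False
      then have "r \<in> {0..<1}" using r by auto
      then show ?thesis
        using v_pos[of r] by (simp flip: quot)
    qed
    finally show "val z r = val ((val (K z) 0 / val v0 0) *\<^sub>R v0) r" by simp
  qed
  moreover from arg_cong[OF this, of ell] ell_z have "val (K z) 0 / val v0 0 = 0"
    by (simp add: linear_scale[OF bounded_linear.linear[OF ell_bounded_linear]] ell_v0)
  ultimately show "z = 0" by simp
qed

text \<open>Orthogonality replaces the integral over \<open>[0,s]\<close> by minus the one over
  \<open>[s,1]\<close>. On the latter the weight is at most a multiple of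
  \<open>v0 s powr (p - 1)\<close>, and the length \<open>1 - s\<close> is at most a multiple of
  \<open>v0 s\<close>, giving the exponent \<open>p\<close> near \<open>1\<close>. For
  \<open>s \<le> 1/2\<close> the eigenfunction is bounded below and a crude bound suffices.\<close>

lemma avg_orthogonal_decay:
  "\<exists>C>0. \<forall>y s. ell y = 0 \<longrightarrow> s \<in> {0..1} \<longrightarrow>
    \<bar>avg N (\<lambda>t. \<beta> t * val v0 t * val y t) s\<bar> \<le> C * norm y * val v0 s powr p"
proof -
  obtain c where c: "c > 0" "\<And>s. s \<in> {1/2..1} \<Longrightarrow> c * (1 - s) \<le> val v0 s"
    using v_lower_bound by blast
  obtain B where B: "B > 0" "\<And>t. t \<in> {0..1} \<Longrightarrow> \<bar>\<beta> t * val v0 t\<bar> \<le> B"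
    using \<beta>_v_bound by blast
  define A where "A = norm f0"
  have \<beta>_le: "\<bar>\<beta> t * val v0 t\<bar> \<le> A * val v0 t powr (p - 1)" if "t \<in> {0..1}" for t
    unfolding \<beta>_v abs_mult abs_phi using abs_val_le_norm[of f0 t] v_nonneg[OF that]
    by (auto intro!: mult_mono simp: A_def)
  \<comment> \<open>The second summand serves \<open>s \<le> 1/2\<close>. The first serves
    \<open>s > 1/2\<close>, where \<open>2 ^ N\<close> pays for dividing by
    \<open>s ^ N\<close>.\<close>
  define C where "C = 2 ^ N * (A / c) + B / val v0 (1/2) powr p"
  have vhalf: "val v0 (1/2) > 0" by (rule v_pos) simp
  have A: "A \<ge> 0" by (simp add: A_def)
  have C_ge: "2 ^ N * (A / c) \<le> C" "B / val v0 (1/2) powr p \<le> C" "C > 0"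
    using A B(1) c(1) vhalf by (auto simp: C_def intro!: add_nonneg_pos)
  have "\<bar>avg N (\<lambda>t. \<beta> t * val v0 t * val y t) s\<bar> \<le> C * norm y * val v0 s powr p"
    if y: "ell y = 0" and s: "s \<in> {0..1}" for y s
  proof (cases "s \<le> 1/2")
    case True
    have "\<bar>avg N (\<lambda>t. \<beta> t * val v0 t * val y t) s\<bar> \<le> B * norm y"
    proof (rule abs_avg_le[OF continuous_on_\<beta>_v_z _ s])
      fix t :: real assume "t \<in> {0..1}"
      then show "\<bar>\<beta> t * val v0 t * val y t\<bar> \<le> B * norm y"
        unfolding abs_mult[of _ "val y t"] using B abs_val_le_norm[of y t]
        by (intro mult_mono) auto
    qed
    also have "\<dots> = B / val v0 (1/2) powr p * norm y * val v0 (1/2) powr p"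
      using vhalf by simp
    also have "\<dots> \<le> C * norm y * val v0 s powr p"
      using C_ge True s v_antimono[of s "1/2"] vhalf p
      by (intro mult_mono powr_mono2) auto
    finally show ?thesis .
  next
    case False
    then have s': "s \<in> {1/2..1}" using s by auto
    let ?g = "\<lambda>t. t ^ (N - 1) * (\<beta> t * val v0 t * val y t)"
    have g: "continuous_on {0..1} ?g"
      by (intro continuous_on_mult continuous_on_power continuous_on_id continuous_on_\<beta> continuous_on_val)
    have "integral {0..s} ?g + integral {s..1} ?g = integral {0..1} ?g"
      using s by (intro Henstock_Kurzweil_Integration.integral_combine integrable_continuous_real g) auto
    also have "\<dots> = 0"
      using y by (simp add: ell_def avg_def)
    finally have "s ^ N * avg N (\<lambda>t. \<beta> t * val v0 t * val y t) s = - integral {s..1} ?g"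
      using I_eq_avg[OF continuous_on_\<beta>_v_z s, of y] by (simp add: I_def)
    also have "\<bar>\<dots>\<bar> \<le> A * val v0 s powr (p - 1) * norm y * (1 - s)"
    proof -
      have "norm (integral {s..1} ?g) \<le> A * val v0 s powr (p - 1) * norm y * (1 - s)"
      proof (rule integral_bound)
        show "continuous_on {s..1} ?g"
          by (rule continuous_on_subset[OF g]) (use s in auto)
        fix t assume "t \<in> {s..1}"
        then have t: "t \<in> {0..1}" "s \<le> t" using s by auto
        have "\<bar>\<beta> t * val v0 t\<bar> \<le> A * val v0 s powr (p - 1)"
          using order_trans[OF \<beta>_le[OF t(1)] mult_left_mono[OF powr_mono2 A]]
            v_antimono[OF s t] v_nonneg[OF t(1)] p by simp
        then have "\<bar>\<beta> t * val v0 t\<bar> * \<bar>val y t\<bar> \<le> A * val v0 s powr (p - 1) * norm y"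
          using abs_val_le_norm[of y t] A by (intro mult_mono) auto
        moreover have "\<bar>t ^ (N - 1)\<bar> \<le> 1"
          using t by (auto intro: power_le_one)
        ultimately show "norm (?g t) \<le> A * val v0 s powr (p - 1) * norm y"
          using mult_mono[of "\<bar>t ^ (N - 1)\<bar>" 1 "\<bar>\<beta> t * val v0 t\<bar> * \<bar>val y t\<bar>"
              "A * val v0 s powr (p - 1) * norm y"] by (simp add: abs_mult)
      qed (use s in simp)
      then show ?thesis by simp
    qed
    also have "\<dots> \<le> A * val v0 s powr (p - 1) * norm y * (val v0 s / c)"
      using c(2)[OF s'] c(1) A by (intro mult_left_mono) (auto simp: field_simps)
    also have "\<dots> = A / c * norm y * val v0 s powr p"
    proof -
      have "val v0 s powr (p - 1) * val v0 s = val v0 s powr p"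
        using v_nonneg[OF s] powr_add[of "val v0 s" "p - 1" 1] by simp
      then show ?thesis by (simp add: field_simps)
    qed
    finally have "s ^ N * \<bar>avg N (\<lambda>t. \<beta> t * val v0 t * val y t) s\<bar> \<le> A / c * norm y * val v0 s powr p"
      using s by (simp add: abs_mult)
    moreover have "(1/2) ^ N \<le> s ^ N"
      using False by (intro power_mono) auto
    ultimately have "(1/2) ^ N * \<bar>avg N (\<lambda>t. \<beta> t * val v0 t * val y t) s\<bar> \<le> A / c * norm y * val v0 s powr p"
      by (meson abs_ge_zero mult_right_mono order_trans)
    then have "\<bar>avg N (\<lambda>t. \<beta> t * val v0 t * val y t) s\<bar> \<le> 2 ^ N * (A / c) * norm y * val v0 s powr p"
      by (simp add: power_divide field_simps)
    also have "\<dots> \<le> C * norm y * val v0 s powr p"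
      using C_ge by (intro mult_right_mono) auto
    finally show ?thesis .
  qed
  with C_ge(3) show ?thesis by (intro exI[of _ C]) simp
qed

text \<open>Variation of constants: \<open>K z = q * v0\<close>, where \<open>q\<close> has the derivative \<open>- lam0 * \<kappa>\<close> with
  \<open>\<kappa> = m * avg N (\<beta> * v0 * y) / v0\<^sup>2\<close>. The orthogonality \<open>ell y = 0\<close> makes \<open>\<kappa>\<close> continuous
  at \<open>1\<close>.\<close>

lemma bounded_right_inverse_on_kernel:
  "\<exists>C>0. \<forall>y. ell y = 0 \<longrightarrow> (\<exists>z. ell z = 0 \<and> z = y + K z \<and> norm z \<le> C * norm y)"
proof -
  obtain C where C: "C > 0" and decay: "\<And>y s. ell y = 0 \<Longrightarrow> s \<in> {0..1} \<Longrightarrow>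
    \<bar>avg N (\<lambda>t. \<beta> t * val v0 t * val y t) s\<bar> \<le> C * norm y * val v0 s powr p"
    using avg_orthogonal_decay by blast
  obtain B where B: "B > 0" "\<And>s. s \<in> {0..1} \<Longrightarrow> \<bar>m s\<bar> \<le> B"
  proof -
    have "bounded (m ` {0..1})"
      by (intro compact_imp_bounded compact_continuous_image continuous_on_m) simp
    then show ?thesis using that by (auto simp: bounded_pos)
  qed
  define D where "D = B * C * norm v0 powr (p - 2)"
  have D: "D \<ge> 0" using B C by (simp add: D_def)
  obtain E where E: "E > 0" "\<And>t. t \<in> {0..1} \<Longrightarrow> \<bar>\<beta> t * val v0 t\<bar> \<le> E"
    using \<beta>_v_bound by blast
  define q_bound where "q_bound = lam0 * (E * norm v0 * D) + lam0 * D"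
  have "\<exists>z. ell z = 0 \<and> z = y + K z \<and> norm z \<le> (1 + norm v0 * q_bound) * norm y" if y: "ell y = 0" for y
  proof -
    let ?a = "avg N (\<lambda>t. \<beta> t * val v0 t * val y t)"
    \<comment> \<open>The value \<open>0\<close> at \<open>s = 1\<close> is the limit: decay of
      order \<open>v0 powr p\<close> divided by \<open>v0\<^sup>2\<close> leaves
      \<open>v0 powr (p - 2)\<close>, which vanishes there as \<open>p > 2\<close>.\<close>
    define \<kappa> where "\<kappa> s = (if s = 1 then 0 else m s * ?a s / (val v0 s * val v0 s))" for s
    have \<kappa>_le: "\<bar>\<kappa> s\<bar> \<le> B * C * norm y * val v0 s powr (p - 2)" if s: "s \<in> {0..1}" for s
    proof (cases "s = 1")
      case False
      have vs: "val v0 s > 0" using s False by (intro v_pos) auto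
      have "\<bar>m s * ?a s\<bar> \<le> B * (C * norm y * val v0 s powr p)"
        unfolding abs_mult using B decay[OF y s] s by (intro mult_mono) auto
      also have "val v0 s powr p = val v0 s powr (p - 2) * (val v0 s * val v0 s)"
        using vs powr_add[of "val v0 s" "p - 2" 2] by (simp add: power2_eq_square)
      finally show ?thesis
        using vs False by (simp add: \<kappa>_def abs_mult divide_le_eq mult_ac)
    qed (simp add: \<kappa>_def v_1)
    have \<kappa>_le': "\<bar>\<kappa> s\<bar> \<le> D * norm y" if s: "s \<in> {0..1}" for s
    proof -
      have "val v0 s powr (p - 2) \<le> norm v0 powr (p - 2)"
        using p v_nonneg[OF s] abs_val_le_norm[of v0 s] by (intro powr_mono2) auto
      then have "B * C * norm y * val v0 s powr (p - 2) \<le> B * C * norm y * norm v0 powr (p - 2)"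
        using B C by (intro mult_left_mono) auto
      with \<kappa>_le[OF s] show ?thesis by (simp add: D_def mult_ac)
    qed
    have \<kappa>_cont: "continuous_on {0..1} \<kappa>"
      unfolding continuous_on_eq_continuous_within
    proof
      fix s :: real assume s: "s \<in> {0..1}"
      show "continuous (at s within {0..1}) \<kappa>"
      proof (cases "s = 1")
        case False
        have "continuous_on {0..<1} (\<lambda>s. m s * ?a s / (val v0 s * val v0 s))"
          by (intro continuous_on_divide continuous_on_mult continuous_on_val
              continuous_on_subset[OF continuous_on_m] continuous_on_subset[OF continuous_on_avg[OF continuous_on_\<beta>_v_z]])
            (use v_pos in force)+
        then have "continuous_on {0..<1} \<kappa>"
          by (rule continuous_on_eq) (simp add: \<kappa>_def)
        moreover have "s \<in> {0..<1}" using s False by auto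
        ultimately have "continuous (at s within {0..<1}) \<kappa>"
          by (simp add: continuous_on_eq_continuous_within)
        moreover have "at s within {0..<1} = at s within {0..1}"
          by (rule at_within_nhd[where S = "{..<1}"]) (use s False in auto)
        ultimately show ?thesis by simp
      next
        case True
        have v_cont: "(val v0 \<longlongrightarrow> 0) (at 1 within {0..1})"
          using continuous_on_val[of "{0..1}" v0, unfolded continuous_on_def, rule_format, of 1] v_1 by simp
        have "((\<lambda>s. val v0 s powr (p - 2)) \<longlongrightarrow> 0 powr (p - 2)) (at 1 within {0..1})"
          by (rule tendsto_powr'[OF v_cont tendsto_const]) (use p v_nonneg in \<open>auto simp: eventually_at_filter\<close>)
        then have "((\<lambda>s. B * C * norm y * val v0 s powr (p - 2)) \<longlongrightarrow> B * C * norm y * 0) (at 1 within {0..1})"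
          by (intro tendsto_mult tendsto_const) simp
        then have "(\<kappa> \<longlongrightarrow> 0) (at 1 within {0..1})"
          by (intro Lim_null_comparison[of \<kappa> "\<lambda>s. B * C * norm y * val v0 s powr (p - 2)"])
            (use \<kappa>_le in \<open>auto simp: eventually_at_filter\<close>)
        then show ?thesis using True by (simp add: continuous_within \<kappa>_def)
      qed
    qed
    define Q where "Q r = integral {0..r} \<kappa>" for r
    have Q': "(Q has_real_derivative \<kappa> r) (at r within {0..1})" if "r \<in> {0..1}" for r
      unfolding Q_def[abs_def] by (rule integral_has_real_derivative[OF \<kappa>_cont that])
    have Q_cont: "continuous_on {0..1} Q"
      by (rule DERIV_continuous_on[OF Q'])
    have Q_le: "\<bar>Q r\<bar> \<le> D * norm y" if r: "r \<in> {0..1}" for r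
    proof -
      have "norm (integral {0..r} \<kappa>) \<le> D * norm y * (r - 0)"
        by (rule integral_bound) (use r \<kappa>_le' continuous_on_subset[OF \<kappa>_cont] in auto)
      also have "\<dots> \<le> D * norm y * 1"
        using r D by (intro mult_left_mono) auto
      finally show ?thesis by (simp add: Q_def)
    qed
    let ?b = "\<lambda>t. \<beta> t * val v0 t * (val v0 t * Q t)"
    have b_cont: "continuous_on {0..1} ?b"
      by (intro continuous_on_mult continuous_on_\<beta> continuous_on_val Q_cont)
    have c0_le: "\<bar>avg N ?b 1\<bar> \<le> E * norm v0 * D * norm y"
    proof (rule abs_avg_le[OF b_cont])
      fix t :: real assume t: "t \<in> {0..1}"
      have "\<bar>\<beta> t * val v0 t\<bar> * (\<bar>val v0 t\<bar> * \<bar>Q t\<bar>) \<le> E * (norm v0 * (D * norm y))"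
        using E(2)[OF t] E(1) abs_val_le_norm[of v0 t] Q_le[OF t] D
        by (intro mult_mono) auto
      then show "\<bar>?b t\<bar> \<le> E * norm v0 * D * norm y"
        by (simp add: abs_mult mult_ac)
    qed simp
    \<comment> \<open>The solution is determined up to multiples of \<open>v0\<close>. The constant
      is \<open>lam0\<close> times the value of \<open>ell\<close> at the product
      \<open>v0 * Q\<close>, which makes \<open>ell z = 0\<close> because
      \<open>ell v0 = 1\<close>.\<close>
    define q where "q r = lam0 * avg N ?b 1 - lam0 * Q r" for r
    have q_cont: "continuous_on {0..1} q"
      unfolding q_def[abs_def] by (intro continuous_intros Q_cont)
    have q': "(q has_real_derivative - (lam0 * \<kappa> r)) (at r within {0..1})" if "r \<in> {0..1}" for r
      unfolding q_def[abs_def] using DERIV_diff[OF DERIV_const DERIV_cmult[OF Q'[OF that]]] by simp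
    have q_le: "\<bar>q r\<bar> \<le> q_bound * norm y" if r: "r \<in> {0..1}" for r
    proof -
      have "\<bar>q r\<bar> \<le> lam0 * \<bar>avg N ?b 1\<bar> + lam0 * \<bar>Q r\<bar>"
        unfolding q_def using lam0 abs_triangle_ineq4[of "lam0 * avg N ?b 1" "lam0 * Q r"]
        by (simp add: abs_mult)
      also have "\<dots> \<le> lam0 * (E * norm v0 * D * norm y) + lam0 * (D * norm y)"
        using lam0 c0_le Q_le[OF r] by (intro add_mono mult_left_mono) auto
      finally show ?thesis by (simp add: q_bound_def algebra_simps)
    qed
    define z where "z = restr01 (\<lambda>r. val y r + val v0 r * q r)"
    have val_z: "val z r = val y r + val v0 r * q r" if "r \<in> {0..1}" for r
      unfolding z_def
      by (rule val_restr01[OF _ that]) (intro continuous_on_add continuous_on_mult continuous_on_val q_cont)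
    have "norm z \<le> (1 + norm v0 * q_bound) * norm y"
    proof (rule norm_C01_le)
      fix r :: real assume r: "r \<in> {0..1}"
      have "\<bar>val z r\<bar> \<le> \<bar>val y r\<bar> + \<bar>val v0 r\<bar> * \<bar>q r\<bar>"
        using abs_triangle_ineq[of "val y r" "val v0 r * q r"] by (simp add: val_z[OF r] abs_mult)
      also have "\<dots> \<le> norm y + norm v0 * (q_bound * norm y)"
        using abs_val_le_norm[of y r] abs_val_le_norm[of v0 r] q_le[OF r]
        by (intro add_mono mult_mono) auto
      finally show "\<bar>val z r\<bar> \<le> (1 + norm v0 * q_bound) * norm y"
        by (simp add: algebra_simps)
    qed
    moreover have "ell z = 0"
    proof -
      let ?g = "\<lambda>t. \<beta> t * val v0 t * val y t + lam0 * avg N ?b 1 * (\<beta> t * val v0 t * val v0 t)"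
      have g_cont: "continuous_on {0..1} ?g"
        by (intro continuous_on_add continuous_on_mult continuous_on_const continuous_on_\<beta>_v_z
            continuous_on_\<beta> continuous_on_val)
      have "ell z = avg N (\<lambda>t. ?g t - lam0 * ?b t) 1"
        unfolding ell_def by (rule avg_cong) (simp_all add: val_z q_def algebra_simps)
      also have "\<dots> = avg N ?g 1 - avg N (\<lambda>t. lam0 * ?b t) 1"
        by (rule avg_diff[OF g_cont continuous_on_mult[OF continuous_on_const b_cont]]) simp
      also have "avg N ?g 1 = ell (y + (lam0 * avg N ?b 1) *\<^sub>R v0)"
        unfolding ell_def by (rule avg_cong) (simp_all add: algebra_simps)
      also have "\<dots> = lam0 * avg N ?b 1"
        using y ell_bounded_linear by (simp add: linear_simps ell_v0)
      finally show ?thesis by (simp only: avg_cmult diff_self)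
    qed
    moreover have "z = y + K z"
    proof (rule C01_eqI)
      let ?A = "\<lambda>t. \<beta> t * val v0 t" and ?Y = "\<lambda>t. \<beta> t * val v0 t * val y t" and ?Z = "\<lambda>t. \<beta> t * val z t"
      \<comment> \<open>Up to the factor \<open>- lam0\<close>, \<open>I ?Z\<close> is the flux of
        \<open>K z\<close>; the right-hand side is what the derivative of \<open>v0 * q\<close>
        requires. Both vanish at \<open>0\<close>, and on differentiation the term with \<kappa>
        cancels the one from \<open>1 / v0\<close>.\<close>
      have IZ: "I ?Z r = I ?A r * q r + I ?Y r / val v0 r" if r: "r \<in> {0..<1}" for r
      proof -
        have "I ?Z r - (I ?A r * q r + I ?Y r / val v0 r)
            = I ?Z 0 - (I ?A 0 * q 0 + I ?Y 0 / val v0 0)"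
        proof (rule has_real_derivative_zero_on_half_open[OF _ r])
          fix r :: real assume r: "r \<in> {0..<1}"
          then have r': "r \<in> {0..1}" by auto
          have v: "val v0 r \<noteq> 0" using v_pos[OF r] by simp
          let ?D = "r ^ (N - 1) * ?Z r - ((r ^ (N - 1) * ?A r * q r + - (lam0 * \<kappa> r) * I ?A r) +
             (r ^ (N - 1) * ?Y r * val v0 r - I ?Y r * - (lam0 * (m r * avg N ?A r))) / (val v0 r * val v0 r))"
          have "((\<lambda>r. I ?Z r - (I ?A r * q r + I ?Y r / val v0 r)) has_real_derivative ?D) (at r within {0..1})"
            by (intro DERIV_diff DERIV_add DERIV_mult DERIV_divide has_real_derivative_I q' has_real_derivative_v'
                continuous_on_\<beta>_z continuous_on_\<beta>_v continuous_on_\<beta>_v_z r' v)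
          moreover have "?D = 0"
          proof -
            have "\<kappa> r = m r * ?a r / (val v0 r * val v0 r)"
              using r by (simp add: \<kappa>_def)
            moreover have "I ?A r = r ^ N * avg N ?A r" "I ?Y r = r ^ N * ?a r"
              by (simp_all only: I_eq_avg[OF _ r'] continuous_on_\<beta>_v continuous_on_\<beta>_v_z)
            moreover have "?Z r = ?A r * q r + \<beta> r * val y r"
              by (simp add: val_z[OF r'] algebra_simps)
            ultimately show ?thesis
              using v by (simp add: field_simps)
          qed
          ultimately show "((\<lambda>r. I ?Z r - (I ?A r * q r + I ?Y r / val v0 r)) has_real_derivative 0) (at r within {0..1})"
            by simp
        qed
        then show ?thesis by simp
      qed
      fix r :: real assume r: "r \<in> {0..1}"
      \<comment> \<open>The flux identity divides by \<open>v0\<close> and holds only below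
        \<open>1\<close>; at the endpoint continuity of \<open>v0 * q\<close> is enough.\<close>
      have "((\<lambda>s. - (lam0 * (m s * avg N ?Z s))) has_integral val v0 1 * q 1 - val v0 r * q r) {r..1}"
      proof (rule fundamental_theorem_of_calculus_interior)
        show "continuous_on {r..1} (\<lambda>r. val v0 r * q r)"
          by (intro continuous_on_mult continuous_on_val continuous_on_subset[OF q_cont]) (use r in auto)
        fix s assume "s \<in> {r<..<1}"
        then have s: "s \<in> {0<..<1}" "s \<in> {0..1}" "s \<in> {0..<1}" using r by auto
        have v: "val v0 s \<noteq> 0" using v_pos[OF s(3)] by simp
        have "at s within {0..1} = at s"
          by (rule at_within_interior) (use s in simp)
        with DERIV_mult[OF has_real_derivative_v'[OF s(2)] q'[OF s(2)]]
        have "((\<lambda>r. val v0 r * q r) has_real_derivative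
            - (lam0 * (m s * avg N ?A s)) * q s + - (lam0 * \<kappa> s) * val v0 s) (at s)"
          by simp
        moreover have "- (lam0 * (m s * avg N ?A s)) * q s + - (lam0 * \<kappa> s) * val v0 s
            = - (lam0 * (m s * avg N ?Z s))"
        proof -
          have "s ^ N * avg N ?Z s = s ^ N * (avg N ?A s * q s + ?a s / val v0 s)"
            using IZ[OF s(3)] unfolding I_eq_avg[OF continuous_on_\<beta>_v s(2)]
              I_eq_avg[OF continuous_on_\<beta>_v_z s(2)] I_eq_avg[OF continuous_on_\<beta>_z s(2)]
            by (simp add: distrib_left mult.assoc)
          then have "avg N ?Z s = avg N ?A s * q s + ?a s / val v0 s"
            using s by simp
          moreover have "\<kappa> s * val v0 s = m s * (?a s / val v0 s)"
            using s v by (simp add: \<kappa>_def)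
          ultimately show ?thesis by (simp add: algebra_simps)
        qed
        ultimately show "((\<lambda>r. val v0 r * q r) has_vector_derivative - (lam0 * (m s * avg N ?Z s))) (at s)"
          by (simp add: has_real_derivative_iff_has_vector_derivative)
      qed (use r in simp)
      from has_integral_neg[OF this]
      have "((\<lambda>s. lam0 * (m s * avg N ?Z s)) has_integral val v0 r * q r) {r..1}"
        by (simp add: v_1)
      then have "val (K z) r = val v0 r * q r"
        by (simp only: val_K[OF r] integral_unique)
      then show "val z r = val (y + K z) r"
        by (simp add: val_z[OF r])
    qed
    ultimately show ?thesis by blast
  qed
  moreover have "1 + norm v0 * q_bound > 0"
    using lam0 E(1) D by (auto simp: q_bound_def intro!: add_pos_nonneg)
  ultimately show ?thesis by blast
qed

end

section \<open>The bifurcation equation\<close>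

lemma restr01_cong: "(\<And>r. r \<in> {0..1} \<Longrightarrow> g r = h r) \<Longrightarrow> restr01 g = restr01 h"
  unfolding restr01_def by (rule arg_cong[of _ _ Bcontfun]) auto

lemma norm_components_le:
  fixes x :: "'a::real_normed_vector \<times> 'b::real_normed_vector"
  shows "norm (fst x) \<le> norm x" "norm (snd x) \<le> norm x"
  using norm_fst_le[of "fst x" "snd x"] norm_snd_le[of "snd x" "fst x"] by simp_all

locale bifurcation = p_homogeneous_at_0 p f f0 + radial_eigenpair N p lam0 f0 v0
  for p f f0 N lam0 v0
begin

definition H :: "real \<Rightarrow> real \<times> C01 \<Rightarrow> C01"
  where "H s x = restr01 (\<lambda>r. fst x * F r s (val (v0 + snd x) r))"

definition H' :: "real \<times> C01 \<Rightarrow> C01"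
  where "H' x = (fst x / lam0) *\<^sub>R h0 + (lam0 * (p - 1)) *\<^sub>R Mult (snd x)"

definition S' :: "C01 \<Rightarrow> C01"
  where "S' k = \<alpha> *\<^sub>R avg_int N m k"

definition T :: "real \<times> C01 \<Rightarrow> C01"
  where "T x = snd x - (fst x * \<alpha> / lam0) *\<^sub>R v0 - K (snd x)"

text \<open>\<open>H'\<close>, \<open>S'\<close> and \<open>T\<close> are the derivatives of \<open>H 0\<close>, \<open>S_p p N\<close> and \<open>G\<close> (for \<open>s = 0\<close>) at
  \<open>(lam0, 0)\<close>, \<open>h0\<close> and \<open>(lam0, 0)\<close>.\<close>

lemma G_eq: "G p N f f0 v0 s lam z = v0 + z - S_p p N (H s (lam, z))"
proof (cases "s = 0")
  case True
  have "restr01 (\<lambda>r. lam * val f0 r * phi p (val v0 r + val z r)) = H s (lam, z)"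
    by (simp add: H_def True F_0 mult.assoc)
  then show ?thesis by (simp add: G_def True)
next
  case False
  have "restr01 (\<lambda>r. lam * f r (s * val v0 r + s * val z r) / phi p s) = H s (lam, z)"
    unfolding H_def by (rule restr01_cong) (simp add: F_nonzero[OF False] distrib_left)
  then show ?thesis using False by (simp add: G_def)
qed

lemma H_0: "H 0 (lam0, 0) = h0"
  by (simp add: H_def h0_def F_0 mult.assoc)

lemma F_slice_cont: "continuous_on ({0..1} \<times> UNIV) (\<lambda>(r, s). F r s (val u r))"
proof -
  have "continuous_on ({0..1} \<times> UNIV) (\<lambda>y. (\<lambda>(r, s, x). F r s x) (fst y, snd y, val u (fst y)))"
    by (intro continuous_on_compose2[OF continuous_on_F] continuous_on_Pair
        continuous_on_compose2[OF continuous_on_val[of UNIV]] continuous_intros) auto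
  then show ?thesis by (simp add: case_prod_unfold)
qed

lemma val_H: "r \<in> {0..1} \<Longrightarrow> val (H s x) r = fst x * F r s (val (v0 + snd x) r)"
  unfolding H_def
proof (rule val_restr01)
  have "continuous_on {0..1} (\<lambda>r. (\<lambda>(r, s). F r s (val (v0 + snd x) r)) (r, s))"
    by (rule continuous_on_compose2[OF F_slice_cont]) (auto intro!: continuous_intros)
  then show "continuous_on {0..1} (\<lambda>r. fst x * F r s (val (v0 + snd x) r))"
    by (intro continuous_on_mult continuous_on_const) simp
qed

lemma continuous_on_H: "continuous_on A (\<lambda>s. H s x)"
  unfolding H_def
proof (rule continuous_on_restr01_param)
  have "continuous_on (A \<times> {0..1}) (\<lambda>y. (\<lambda>(r, s). F r s (val (v0 + snd x) r)) (snd y, fst y))"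
    by (rule continuous_on_compose2[OF F_slice_cont]) (auto intro!: continuous_intros)
  then show "continuous_on (A \<times> {0..1}) (\<lambda>(s, r). fst x * F r s (val (v0 + snd x) r))"
    unfolding case_prod_unfold by (intro continuous_on_mult continuous_on_const) simp
qed

lemma S'_eq: "S' = avg_int N (\<lambda>s. \<alpha> * s powr \<alpha> * avg N (val h0) s powr (\<alpha> - 1))"
proof
  fix k
  show "S' k = avg_int N (\<lambda>s. \<alpha> * s powr \<alpha> * avg N (val h0) s powr (\<alpha> - 1)) k"
    unfolding S'_def
  proof (rule C01_eqI)
    fix r :: real assume r: "r \<in> {0..1}"
    have "continuous_on {0..1} (\<lambda>s. \<alpha> * m s)"
      by (intro continuous_on_mult continuous_on_const continuous_on_m)
    from val_avg_int[OF this r, of N k]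
    show "val (\<alpha> *\<^sub>R avg_int N m k) r =
        val (avg_int N (\<lambda>s. \<alpha> * s powr \<alpha> * avg N (val h0) s powr (\<alpha> - 1)) k) r"
      by (simp add: val_avg_int[OF continuous_on_m r] m_def w0_def mult.assoc)
  qed
qed

lemma linear_S': "linear S'"
  using linear_compose_scale_right[OF linear_avg_int[OF continuous_on_m, of N], of \<alpha>]
  by (simp add: S'_def[abs_def])

text \<open>Varying \<lambda> moves along \<open>h0\<close>, which \<open>S'\<close> sends to a
  multiple of \<open>v0\<close>: exactly the direction missing from the range of
  \<open>z - K z\<close>. In the other term \<open>(p - 1) * \<alpha> = 1\<close> leaves
  \<open>K\<close>.\<close>

lemma S'_H': "S' (H' x) = (fst x * \<alpha> / lam0) *\<^sub>R v0 + K (snd x)"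
proof -
  note lin = linear_add[OF linear_avg_int[OF continuous_on_m]] linear_scale[OF linear_avg_int[OF continuous_on_m]]
  have "S' (H' x) = (\<alpha> * (fst x / lam0)) *\<^sub>R v0 + (lam0 * ((p - 1) * \<alpha>)) *\<^sub>R avg_int N m (Mult (snd x))"
    by (simp add: S'_def H'_def lin avg_int_h0 scaleR_add_right mult_ac)
  then show ?thesis
    unfolding \<alpha>(2) by (simp add: K_def mult.commute)
qed

lemma S'_bound: "\<exists>M>0. \<forall>k. norm (S' k) \<le> M * norm k"
proof -
  have "bounded (m ` {0..1})"
    by (intro compact_imp_bounded compact_continuous_image continuous_on_m) simp
  then obtain B where B: "B > 0" "\<And>s. s \<in> {0..1} \<Longrightarrow> \<bar>m s\<bar> \<le> B"
    by (auto simp: bounded_pos)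
  have "norm (S' k) \<le> (\<alpha> * B) * norm k" for k
    using norm_avg_int_le[OF continuous_on_m B(2), of N k] \<alpha>(1) by (simp add: S'_def mult.assoc)
  then show ?thesis using B(1) \<alpha>(1) by (intro exI[of _ "\<alpha> * B"]) auto
qed

lemma H'_bound: "\<exists>M>0. \<forall>x. norm (H' x) \<le> M * norm x"
proof -
  have "bounded (\<beta> ` {0..1})"
    by (intro compact_imp_bounded compact_continuous_image continuous_on_\<beta>) simp
  then obtain B where B: "B > 0" "\<And>s. s \<in> {0..1} \<Longrightarrow> \<bar>\<beta> s\<bar> \<le> B"
    by (auto simp: bounded_pos)
  have Mult: "norm (Mult z) \<le> B * norm z" for z
    by (rule norm_C01_le) (use B abs_val_le_norm in \<open>auto simp: val_Mult abs_mult intro!: mult_mono\<close>)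
  have "norm (H' x) \<le> (norm h0 / lam0 + lam0 * (p - 1) * B + 1) * norm x" for x
  proof -
    have "norm (H' x) \<le> \<bar>fst x\<bar> / lam0 * norm h0 + lam0 * (p - 1) * norm (Mult (snd x))"
      unfolding H'_def using lam0 p by (intro norm_triangle_le) simp
    also have "\<dots> \<le> norm x / lam0 * norm h0 + lam0 * (p - 1) * (B * norm x)"
      using lam0 p B(1) norm_components_le(1)[of x]
        order_trans[OF Mult mult_left_mono[OF norm_components_le(2)], of x]
      by (intro add_mono mult_right_mono mult_left_mono divide_right_mono) auto
    also have "\<dots> \<le> (norm h0 / lam0 + lam0 * (p - 1) * B + 1) * norm x"
      by (simp add: algebra_simps)
    finally show ?thesis .
  qed
  moreover have "norm h0 / lam0 + lam0 * (p - 1) * B + 1 > 0"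
    using lam0 p B(1) by (intro add_nonneg_pos add_nonneg_nonneg) auto
  ultimately show ?thesis by blast
qed

section \<open>Strict differentiability of the argument of \<open>S_p\<close>\<close>

lemma H_near_h0:
  assumes "\<eta> > 0"
  shows "\<exists>\<delta>>0. \<forall>s x. \<bar>s\<bar> < \<delta> \<longrightarrow> dist x (lam0, 0) < \<delta> \<longrightarrow> (\<forall>r\<in>{0..1}.
    \<bar>F r s (val (v0 + snd x) r) - F r 0 (val v0 r)\<bar> \<le> \<eta>)"
proof -
  obtain \<delta> where \<delta>: "\<delta> > 0" "\<And>s \<tau> r. \<bar>s\<bar> < \<delta> \<Longrightarrow> \<bar>\<tau>\<bar> < \<delta> \<Longrightarrow> r \<in> {0..1} \<Longrightarrow>
    \<bar>F r s (val v0 r + \<tau>) - F r 0 (val v0 r)\<bar> \<le> \<eta>"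
    using uniform_near_zero_shift[OF continuous_on_F assms, of v0] by blast
  have "\<bar>F r s (val (v0 + snd x) r) - F r 0 (val v0 r)\<bar> \<le> \<eta>"
    if "\<bar>s\<bar> < \<delta>" "dist x (lam0, 0) < \<delta>" "r \<in> {0..1}" for s x r
    using \<delta>(2)[of s "val (snd x) r" r] that abs_val_le_norm[of "snd x" r]
      dist_snd_le[of x "(lam0, 0)"] by simp
  with \<delta>(1) show ?thesis by blast
qed

lemma H_strict_derivative:
  assumes "\<eta> > 0"
  shows "\<exists>\<delta>>0. \<forall>s x y. \<bar>s\<bar> < \<delta> \<longrightarrow> dist x (lam0, 0) < \<delta> \<longrightarrow> dist y (lam0, 0) < \<delta> \<longrightarrow>
    norm (H s x - H s y - H' (x - y)) \<le> \<eta> * norm (x - y)"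
proof -
  have "bounded (\<beta> ` {0..1})"
    by (intro compact_imp_bounded compact_continuous_image continuous_on_\<beta>) simp
  then obtain B where B: "B > 0" "\<And>s. s \<in> {0..1} \<Longrightarrow> \<bar>\<beta> s\<bar> \<le> B"
    by (auto simp: bounded_pos)
  \<comment> \<open>The error \<open>e\<close> occurs with the factors
    \<open>\<bar>fst x\<bar> \<le> lam0 + 1\<close> and \<open>1\<close>, together half of \<eta>;
    the choice of \<open>\<delta>3\<close> below accounts for the other half.\<close>
  define e where "e = \<eta> / (2 * (lam0 + 2))"
  have e: "e > 0" using assms lam0 by (simp add: e_def)
  obtain \<delta>1 where \<delta>1: "\<delta>1 > 0" "\<And>s x r. \<bar>s\<bar> < \<delta>1 \<Longrightarrow> dist x (lam0, 0) < \<delta>1 \<Longrightarrow> r \<in> {0..1} \<Longrightarrow>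
    \<bar>F r s (val (v0 + snd x) r) - F r 0 (val v0 r)\<bar> \<le> e"
    using H_near_h0[OF e] by blast
  obtain \<delta>2 where \<delta>2: "\<delta>2 > 0" "\<And>s \<tau> r. \<bar>s\<bar> < \<delta>2 \<Longrightarrow> \<bar>\<tau>\<bar> < \<delta>2 \<Longrightarrow> r \<in> {0..1} \<Longrightarrow>
    \<bar>F' r s (val v0 r + \<tau>) - F' r 0 (val v0 r)\<bar> \<le> e"
    using uniform_near_zero_shift[OF continuous_on_F' e, of v0] by blast
  define \<delta>3 where "\<delta>3 = \<eta> / (2 * ((p - 1) * B))"
  define \<delta> where "\<delta> = min 1 (min \<delta>1 (min \<delta>2 \<delta>3))"
  have \<delta>: "\<delta> > 0" "\<delta> \<le> 1" "\<delta> \<le> \<delta>1" "\<delta> \<le> \<delta>2" "\<delta> \<le> \<delta>3"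
    using \<delta>1(1) \<delta>2(1) assms B(1) p by (auto simp: \<delta>_def \<delta>3_def)
  have est: "norm (H s x - H s y - H' (x - y)) \<le> \<eta> * norm (x - y)"
    if s: "\<bar>s\<bar> < \<delta>" and x: "dist x (lam0, 0) < \<delta>" and y: "dist y (lam0, 0) < \<delta>" for s x y
  proof (rule norm_C01_le)
    fix r :: real assume r: "r \<in> {0..1}"
    let ?u = "val (v0 + snd x) r" and ?w = "val (v0 + snd y) r" and ?d = "F' r 0 (val v0 r)"
    let ?n = "norm (x - y)"
    have "\<bar>val (snd (x - y)) r\<bar> \<le> ?n"
      by (rule order_trans[OF abs_val_le_norm norm_components_le(2)])
    then have diff: "\<bar>?u - ?w\<bar> \<le> ?n" "\<bar>fst x - fst y\<bar> \<le> ?n"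
      using norm_components_le(1)[of "x - y"] by simp_all
    have near: "\<bar>?u - val v0 r\<bar> < \<delta>2" "\<bar>?w - val v0 r\<bar> < \<delta>2"
      using abs_val_le_norm[of "snd x" r] abs_val_le_norm[of "snd y" r]
        dist_snd_le[of x "(lam0, 0)"] dist_snd_le[of y "(lam0, 0)"] x y \<delta>(4) by simp_all
    have lam: "\<bar>fst x - lam0\<bar> < \<delta>3" "\<bar>fst x\<bar> \<le> lam0 + 1"
      using dist_fst_le[of x "(lam0, 0)"] x \<delta>(2,5) lam0 by (auto simp: dist_real_def)
    have mv: "\<bar>F r s ?u - F r s ?w - ?d * (?u - ?w)\<bar> \<le> e * \<bar>?u - ?w\<bar>"
    proof (rule mean_value_bound[of "ball (val v0 r) \<delta>2"])
      show "(F r s has_real_derivative F' r s z) (at z)" for z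
        by (rule has_real_derivative_F[OF r])
      show "\<bar>F' r s z - ?d\<bar> \<le> e" if "z \<in> ball (val v0 r) \<delta>2" for z
        using \<delta>2(2)[of s "z - val v0 r" r] s \<delta>(4) r that
        by (simp add: dist_real_def abs_minus_commute)
    qed (use near in \<open>auto simp: dist_real_def abs_minus_commute\<close>)
    have d: "?d = (p - 1) * \<beta> r"
      by (simp add: F'_0 \<beta>_def)
    have H'_val: "val (H' (x - y)) r = (fst x - fst y) * F r 0 (val v0 r) + lam0 * ?d * (?u - ?w)"
    proof -
      have "val (H' (x - y)) r = (fst x - fst y) / lam0 * (lam0 * (\<beta> r * val v0 r))
          + lam0 * (p - 1) * (\<beta> r * (val (snd x) r - val (snd y) r))"
        by (simp only: H'_def val_add val_scaleR val_diff val_h0[OF r] val_Mult[OF r] fst_diff snd_diff)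
      also have "(fst x - fst y) / lam0 * (lam0 * (\<beta> r * val v0 r)) = (fst x - fst y) * F r 0 (val v0 r)"
        using lam0 by (simp add: \<beta>_v F_0)
      finally show ?thesis
        by (simp only: d val_add mult.assoc add_diff_cancel_left)
    qed
    \<comment> \<open>The product of \<lambda> and \<open>F\<close> is split into the linearization
      error of \<open>F\<close>, the shift of \<lambda> from \<open>lam0\<close>, and the deviation
      of \<open>F\<close> from its value at the base point.\<close>
    have eq: "val (H s x - H s y - H' (x - y)) r = fst x * (F r s ?u - F r s ?w - ?d * (?u - ?w))
        + (fst x - lam0) * (?d * (?u - ?w)) + (fst x - fst y) * (F r s ?w - F r 0 (val v0 r))"
      unfolding val_diff[of "H s x - H s y"] val_diff[of "H s x"] val_H[OF r] H'_val
      by (simp only: algebra_simps)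
    have "\<bar>val (H s x - H s y - H' (x - y)) r\<bar> \<le> \<bar>fst x\<bar> * \<bar>F r s ?u - F r s ?w - ?d * (?u - ?w)\<bar>
        + \<bar>fst x - lam0\<bar> * (\<bar>?d\<bar> * \<bar>?u - ?w\<bar>) + \<bar>fst x - fst y\<bar> * \<bar>F r s ?w - F r 0 (val v0 r)\<bar>"
      unfolding eq abs_mult[symmetric]
      by (rule order_trans[OF abs_triangle_ineq add_right_mono[OF abs_triangle_ineq]])
    also have "\<dots> \<le> (lam0 + 1) * (e * ?n) + \<delta>3 * ((p - 1) * B * ?n) + ?n * e"
    proof (intro add_mono mult_mono)
      show "\<bar>F r s ?u - F r s ?w - ?d * (?u - ?w)\<bar> \<le> e * ?n"
        using mv diff(1) e by (meson less_imp_le mult_left_mono order_trans)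
      show "\<bar>?d\<bar> \<le> (p - 1) * B"
        using B(2)[OF r] p by (simp add: d abs_mult)
      show "\<bar>F r s ?w - F r 0 (val v0 r)\<bar> \<le> e"
        by (rule \<delta>1(2)) (use s y \<delta>(3) r in auto)
    qed (use lam diff lam0 e p B(1) \<delta>(1,5) in auto)
    also have "\<dots> = \<eta> * ?n"
    proof -
      have "(lam0 + 2) * e = \<eta> / 2" "\<delta>3 * ((p - 1) * B) = \<eta> / 2"
        using lam0 p B(1) by (simp_all add: e_def \<delta>3_def field_simps)
      moreover have "(lam0 + 1) * (e * ?n) + \<delta>3 * ((p - 1) * B * ?n) + ?n * e
          = ((lam0 + 2) * e + \<delta>3 * ((p - 1) * B)) * ?n"
        by (simp add: algebra_simps)
      ultimately show ?thesis by simp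
    qed
    finally show "\<bar>val (H s x - H s y - H' (x - y)) r\<bar> \<le> \<eta> * ?n" .
  qed
  show ?thesis by (intro exI[of _ \<delta>] conjI allI impI \<delta>(1) est)
qed

text \<open>Continuity in \<open>s\<close> handles the base point \<open>(lam0, 0)\<close>. The
  strict estimate adds a Lipschitz bound in \<open>x\<close> that is uniform in
  \<open>s\<close>.\<close>

lemma H_tendsto_h0:
  assumes "\<eta> > 0"
  shows "\<exists>\<delta>>0. \<forall>s x. \<bar>s\<bar> < \<delta> \<longrightarrow> dist x (lam0, 0) < \<delta> \<longrightarrow> norm (H s x - h0) < \<eta>"
proof -
  obtain M where M: "M > 0" "\<And>x. norm (H' x) \<le> M * norm x"
    using H'_bound by blast
  obtain \<delta>1 where \<delta>1: "\<delta>1 > 0" "\<And>s x y. \<bar>s\<bar> < \<delta>1 \<Longrightarrow> dist x (lam0, 0) < \<delta>1 \<Longrightarrow> dist y (lam0, 0) < \<delta>1 \<Longrightarrow>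
    norm (H s x - H s y - H' (x - y)) \<le> 1 * norm (x - y)"
    using H_strict_derivative[OF zero_less_one] by (elim exE conjE) blast
  have "\<forall>\<^sub>F s in at 0. dist (H s (lam0, 0)) h0 < \<eta> / 2"
  proof (rule tendstoD)
    show "((\<lambda>s. H s (lam0, 0)) \<longlongrightarrow> h0) (at 0)"
      using continuous_on_H[of UNIV "(lam0, 0)"] unfolding continuous_on_def H_0[symmetric] by simp
  qed (use assms in simp)
  then obtain \<delta>2 where \<delta>2: "\<delta>2 > 0" "\<And>s. \<bar>s\<bar> < \<delta>2 \<Longrightarrow> norm (H s (lam0, 0) - h0) < \<eta> / 2"
  proof -
    obtain d where "d > 0" "\<And>s. s \<noteq> 0 \<Longrightarrow> \<bar>s\<bar> < d \<Longrightarrow> norm (H s (lam0, 0) - h0) < \<eta> / 2"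
      using \<open>\<forall>\<^sub>F s in at 0. dist (H s (lam0, 0)) h0 < \<eta> / 2\<close>
      by (auto simp: eventually_at dist_norm)
    moreover have "norm (H 0 (lam0, 0) - h0) < \<eta> / 2"
      using assms by (simp add: H_0)
    ultimately show ?thesis by (intro that[of d]) (metis, metis)
  qed
  define \<delta> where "\<delta> = min \<delta>1 (min \<delta>2 (\<eta> / (2 * (1 + M))))"
  have \<delta>: "\<delta> > 0" "\<delta> \<le> \<delta>1" "\<delta> \<le> \<delta>2" "\<delta> \<le> \<eta> / (2 * (1 + M))"
    using \<delta>1(1) \<delta>2(1) assms M(1) by (auto simp: \<delta>_def)
  have est: "norm (H s x - h0) < \<eta>" if s: "\<bar>s\<bar> < \<delta>" and x: "dist x (lam0, 0) < \<delta>" for s x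
  proof -
    let ?y = "(lam0, 0) :: real \<times> C01"
    have "norm (H s x - H s ?y - H' (x - ?y)) \<le> 1 * norm (x - ?y)"
      using s x \<delta> \<delta>1(1) by (intro \<delta>1(2)) auto
    then have "norm (H s x - H s ?y) \<le> (1 + M) * norm (x - ?y)"
      using M(2)[of "x - ?y"] norm_triangle_ineq[of "H s x - H s ?y - H' (x - ?y)" "H' (x - ?y)"]
      by (simp add: algebra_simps)
    also have "\<dots> < (1 + M) * (\<eta> / (2 * (1 + M)))"
      using x \<delta>(4) M(1) by (intro mult_strict_left_mono) (auto simp: dist_norm)
    also have "\<dots> = \<eta> / 2" using M(1) by (simp add: field_simps)
    finally show ?thesis
      using \<delta>2(2)[of s] s \<delta>(3) norm_triangle_ineq[of "H s x - H s ?y" "H s ?y - h0"] by simp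
  qed
  show ?thesis by (intro exI[of _ \<delta>] conjI allI impI \<delta>(1) est)
qed

section \<open>The chain rule for \<open>G\<close>\<close>

lemma S_p_strict:
  assumes "\<eta> > 0"
  shows "\<exists>\<delta>>0. \<forall>h k. norm (h - h0) < \<delta> \<longrightarrow> norm (k - h0) < \<delta> \<longrightarrow>
    norm (S_p p N h - S_p p N k - S' (h - k)) \<le> \<eta> * norm (h - k)"
  unfolding S'_eq
  by (rule S_p_strict_derivative[OF _ N \<alpha>_def _ assms]) (use p w0_pos in \<open>auto simp: w0_def\<close>)

lemma G_strict_derivative:
  assumes "\<eta> > 0"
  shows "\<exists>\<delta>>0. \<forall>s x y. \<bar>s\<bar> < \<delta> \<longrightarrow> dist x (lam0, 0) < \<delta> \<longrightarrow> dist y (lam0, 0) < \<delta> \<longrightarrow>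
    norm (G p N f f0 v0 s (fst x) (snd x) - G p N f f0 v0 s (fst y) (snd y) - T (x - y)) \<le> \<eta> * norm (x - y)"
proof -
  obtain M where M: "M > 0" "\<And>k. norm (S' k) \<le> M * norm k"
    using S'_bound by blast
  obtain L where L: "L > 0" "\<And>x. norm (H' x) \<le> L * norm x"
    using H'_bound by blast
  \<comment> \<open>\<open>1 + L\<close> is a Lipschitz constant of \<open>H s\<close>, thanks to
    \<open>\<eta>2 \<le> 1\<close>, and multiplies the error of \<open>S_p\<close>; \<open>M\<close>
    bounds \<open>S'\<close> and multiplies the error of \<open>H s\<close>. Each product is at most
    half of \<eta>.\<close>
  define \<eta>1 where "\<eta>1 = \<eta> / (2 * (1 + L))"
  define \<eta>2 where "\<eta>2 = min 1 (\<eta> / (2 * M))"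
  have \<eta>1: "\<eta>1 > 0" "\<eta>1 * (1 + L) = \<eta> / 2"
    using assms L(1) by (simp_all add: \<eta>1_def field_simps)
  have \<eta>2: "\<eta>2 > 0" "\<eta>2 \<le> 1" using assms M(1) by (auto simp: \<eta>2_def)
  have "\<eta>2 \<le> \<eta> / (2 * M)" by (simp add: \<eta>2_def)
  then have \<eta>2': "M * \<eta>2 \<le> \<eta> / 2" using M(1) by (simp add: field_simps)
  obtain \<delta>1 where \<delta>1: "\<delta>1 > 0" "\<And>h k. norm (h - h0) < \<delta>1 \<Longrightarrow> norm (k - h0) < \<delta>1 \<Longrightarrow>
    norm (S_p p N h - S_p p N k - S' (h - k)) \<le> \<eta>1 * norm (h - k)"
    using S_p_strict[OF \<eta>1(1)] by blast
  obtain \<delta>2 where \<delta>2: "\<delta>2 > 0" "\<And>s x y. \<bar>s\<bar> < \<delta>2 \<Longrightarrow> dist x (lam0, 0) < \<delta>2 \<Longrightarrow> dist y (lam0, 0) < \<delta>2 \<Longrightarrow>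
    norm (H s x - H s y - H' (x - y)) \<le> \<eta>2 * norm (x - y)"
    using H_strict_derivative[OF \<eta>2(1)] by blast
  obtain \<delta>3 where \<delta>3: "\<delta>3 > 0" "\<And>s x. \<bar>s\<bar> < \<delta>3 \<Longrightarrow> dist x (lam0, 0) < \<delta>3 \<Longrightarrow> norm (H s x - h0) < \<delta>1"
    using H_tendsto_h0[OF \<delta>1(1)] by blast
  have est: "norm (G p N f f0 v0 s (fst x) (snd x) - G p N f f0 v0 s (fst y) (snd y) - T (x - y)) \<le> \<eta> * norm (x - y)"
    if s: "\<bar>s\<bar> < min \<delta>2 \<delta>3" and x: "dist x (lam0, 0) < min \<delta>2 \<delta>3" and y: "dist y (lam0, 0) < min \<delta>2 \<delta>3" for s x y
  proof -
    let ?h = "H s x" and ?k = "H s y" and ?n = "norm (x - y)"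
    have H: "norm (?h - ?k - H' (x - y)) \<le> \<eta>2 * ?n"
      using s x y by (intro \<delta>2(2)) auto
    have "norm (?h - ?k) \<le> \<eta>2 * ?n + L * ?n"
      using H L(2)[of "x - y"] norm_triangle_ineq[of "?h - ?k - H' (x - y)" "H' (x - y)"] by simp
    also have "\<dots> \<le> (1 + L) * ?n"
      using \<eta>2(2) mult_right_mono[of \<eta>2 1 ?n] by (simp add: distrib_right)
    finally have hk: "norm (?h - ?k) \<le> (1 + L) * ?n" .
    have eq: "G p N f f0 v0 s (fst x) (snd x) - G p N f f0 v0 s (fst y) (snd y) - T (x - y)
        = - (S_p p N ?h - S_p p N ?k - S' (?h - ?k)) - S' (?h - ?k - H' (x - y))"
      using S'_H'[of "x - y"] by (simp add: G_eq T_def linear_diff[OF linear_S'])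
    have "norm (G p N f f0 v0 s (fst x) (snd x) - G p N f f0 v0 s (fst y) (snd y) - T (x - y))
        \<le> norm (S_p p N ?h - S_p p N ?k - S' (?h - ?k)) + norm (S' (?h - ?k - H' (x - y)))"
      unfolding eq by (rule order_trans[OF norm_triangle_ineq4]) (simp only: norm_minus_cancel order_refl)
    also have "\<dots> \<le> \<eta>1 * ((1 + L) * ?n) + M * (\<eta>2 * ?n)"
    proof (rule add_mono)
      have "norm (S_p p N ?h - S_p p N ?k - S' (?h - ?k)) \<le> \<eta>1 * norm (?h - ?k)"
        using s x y by (intro \<delta>1(2) \<delta>3(2)) auto
      also have "\<dots> \<le> \<eta>1 * ((1 + L) * ?n)"
        using hk \<eta>1(1) by (intro mult_left_mono) auto
      finally show "norm (S_p p N ?h - S_p p N ?k - S' (?h - ?k)) \<le> \<eta>1 * ((1 + L) * ?n)" .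
      show "norm (S' (?h - ?k - H' (x - y))) \<le> M * (\<eta>2 * ?n)"
        using order_trans[OF M(2) mult_left_mono[OF H]] M(1) by simp
    qed
    also have "\<dots> = (\<eta>1 * (1 + L)) * ?n + (M * \<eta>2) * ?n"
      by (simp only: mult.assoc)
    also have "\<dots> \<le> \<eta> / 2 * ?n + \<eta> / 2 * ?n"
      unfolding \<eta>1(2) using \<eta>2' by (intro add_left_mono mult_right_mono) auto
    finally show ?thesis by simp
  qed
  have "min \<delta>2 \<delta>3 > 0"
    using \<delta>2(1) \<delta>3(1) by simp
  then show ?thesis
    by (intro exI[of _ "min \<delta>2 \<delta>3"] conjI allI impI est)
qed

text \<open>Strict differentiability makes \<open>S_p\<close> Lipschitz in a ball around
  \<open>h0\<close>, and \<open>H s x\<close> stays in this ball for small \<open>s\<close> and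
  \<open>x\<close> near \<open>(lam0, 0)\<close>.\<close>

lemma G_continuous:
  "\<exists>\<delta>>0. \<forall>x. dist x (lam0, 0) < \<delta> \<longrightarrow> continuous_on {-\<delta><..<\<delta>} (\<lambda>s. G p N f f0 v0 s (fst x) (snd x))"
proof -
  obtain M where M: "M > 0" "\<And>k. norm (S' k) \<le> M * norm k"
    using S'_bound by blast
  obtain \<delta>1 where \<delta>1: "\<delta>1 > 0" "\<And>h k. norm (h - h0) < \<delta>1 \<Longrightarrow> norm (k - h0) < \<delta>1 \<Longrightarrow>
    norm (S_p p N h - S_p p N k - S' (h - k)) \<le> 1 * norm (h - k)"
    using S_p_strict[OF zero_less_one] by (elim exE conjE) blast
  have "(1 + M)-lipschitz_on (ball h0 \<delta>1) (S_p p N)"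
  proof (rule lipschitz_onI)
    fix h k assume "h \<in> ball h0 \<delta>1" "k \<in> ball h0 \<delta>1"
    then have "norm (S_p p N h - S_p p N k - S' (h - k)) \<le> 1 * norm (h - k)"
      by (intro \<delta>1(2)) (simp_all add: dist_norm norm_minus_commute)
    then show "dist (S_p p N h) (S_p p N k) \<le> (1 + M) * dist h k"
      using M(2)[of "h - k"] norm_triangle_ineq[of "S_p p N h - S_p p N k - S' (h - k)" "S' (h - k)"]
      by (simp add: dist_norm distrib_right)
  qed (use M(1) in simp)
  then have Sp: "continuous_on (ball h0 \<delta>1) (S_p p N)"
    by (rule lipschitz_on_continuous_on)
  obtain \<delta> where \<delta>: "\<delta> > 0" "\<And>s x. \<bar>s\<bar> < \<delta> \<Longrightarrow> dist x (lam0, 0) < \<delta> \<Longrightarrow> norm (H s x - h0) < \<delta>1"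
    using H_tendsto_h0[OF \<delta>1(1)] by blast
  have "continuous_on {-\<delta><..<\<delta>} (\<lambda>s. G p N f f0 v0 s (fst x) (snd x))" if "dist x (lam0, 0) < \<delta>" for x
    unfolding G_eq prod.collapse
    by (intro continuous_on_diff continuous_on_const continuous_on_compose2[OF Sp continuous_on_H])
      (use \<delta>(2)[OF _ that] in \<open>auto simp: dist_norm norm_minus_commute\<close>)
  then show ?thesis
    by (intro exI[of _ \<delta>] conjI allI impI \<delta>(1))
qed

section \<open>Invertibility of the derivative\<close>

lemma linear_K: "linear K"
  unfolding K_def[abs_def] by (rule linearI)
    (simp_all add: linear_add[OF linear_Mult] linear_scale[OF linear_Mult]
      linear_add[OF linear_avg_int[OF continuous_on_m]] linear_scale[OF linear_avg_int[OF continuous_on_m]]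
      scaleR_add_right mult.commute)

lemma linear_T: "linear T"
  unfolding T_def[abs_def] by (rule linearI)
    (simp_all add: linear_add[OF linear_K] linear_scale[OF linear_K] algebra_simps add_divide_distrib)

text \<open>Removing the \<open>v0\<close> component of \<open>y\<close> makes the equation solvable
  for \<open>z\<close> within the kernel of \<open>ell\<close>, and the \<lambda> component restores
  what was removed.\<close>

lemma T_inverse:
  "\<exists>C. \<forall>y. \<exists>x. ell (snd x) = 0 \<and> T x = y \<and> norm x \<le> C * norm y"
proof -
  obtain C where C: "C > 0" "\<And>y. ell y = 0 \<Longrightarrow> \<exists>z. ell z = 0 \<and> z = y + K z \<and> norm z \<le> C * norm y"
    using bounded_right_inverse_on_kernel by blast
  obtain B where B: "B > 0" "\<And>y. \<bar>ell y\<bar> \<le> norm y * B"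
    using bounded_linear.pos_bounded[OF ell_bounded_linear] by auto
  have "\<exists>x. ell (snd x) = 0 \<and> T x = y \<and> norm x \<le> (B * lam0 / \<alpha> + C * (1 + B * norm v0)) * norm y" for y
  proof -
    define y' where "y' = y - ell y *\<^sub>R v0"
    have "ell y' = 0"
      using ell_bounded_linear by (simp add: y'_def linear_simps ell_v0)
    then obtain z where z: "ell z = 0" "z = y' + K z" "norm z \<le> C * norm y'"
      using C(2) by blast
    \<comment> \<open>The value solves \<open>- (\<mu> * \<alpha> / lam0) = ell y\<close>.\<close>
    let ?\<mu> = "- (ell y * lam0 / \<alpha>)"
    have "T (?\<mu>, z) = z + ell y *\<^sub>R v0 - K z"
      using lam0 \<alpha>(1) by (simp add: T_def)
    also have "\<dots> = y"
      using z(2) by (simp add: y'_def algebra_simps)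
    finally have T: "T (?\<mu>, z) = y" .
    have "norm y' \<le> (1 + B * norm v0) * norm y"
      using norm_triangle_ineq4[of y "ell y *\<^sub>R v0"] mult_right_mono[OF B(2)[of y] norm_ge_zero[of v0]]
      by (simp add: y'_def algebra_simps)
    then have "norm z \<le> C * ((1 + B * norm v0) * norm y)"
      using z(3) C(1) by (meson less_imp_le mult_left_mono order_trans)
    moreover have "norm ?\<mu> \<le> B * lam0 / \<alpha> * norm y"
      using mult_right_mono[OF B(2)[of y], of "lam0 / \<alpha>"] lam0 \<alpha>(1) by (simp add: abs_mult mult_ac)
    ultimately have "norm (?\<mu>, z) \<le> (B * lam0 / \<alpha> + C * (1 + B * norm v0)) * norm y"
      using norm_Pair_le[of ?\<mu> z] by (simp add: algebra_simps)
    with T z(1) show ?thesis by (intro exI[of _ "(?\<mu>, z)"]) simp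
  qed
  then show ?thesis by blast
qed

lemma T_injective:
  assumes "ell (snd x) = 0" "T x = 0"
  shows "x = 0"
proof -
  have "snd x = (fst x * \<alpha> / lam0) *\<^sub>R v0 + K (snd x)"
    using assms(2) by (simp add: T_def algebra_simps)
  from linearization_injective[OF assms(1) this] show ?thesis
    using \<alpha>(1) lam0 by (simp add: prod_eq_iff)
qed

theorem bifurcation_curve:
  "\<exists>\<epsilon>>0. \<exists>\<rho>>0. \<exists>x. continuous_on {-\<epsilon><..<\<epsilon>} x \<and> x 0 = (lam0, 0) \<and>
    (\<forall>s\<in>{-\<epsilon><..<\<epsilon>}. x s \<in> (UNIV \<times> Z p N f0 v0) \<inter> ball (lam0, 0) \<rho> \<and>
      (\<forall>y\<in>(UNIV \<times> Z p N f0 v0) \<inter> ball (lam0, 0) \<rho>. G p N f f0 v0 s (fst y) (snd y) = 0 \<longleftrightarrow> y = x s))"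
proof -
  let ?V = "UNIV \<times> Z p N f0 v0 :: (real \<times> C01) set"
  have Z: "y \<in> ?V \<longleftrightarrow> ell (snd y) = 0" for y
    by (auto simp: Z_eq mem_Times_iff)
  have lin: "linear ell"
    by (rule bounded_linear.linear[OF ell_bounded_linear])
  have sub: "subspace ?V"
    by (auto simp: subspace_def Z linear_add[OF lin] linear_scale[OF lin] linear_0[OF lin])
  have "closed (Z p N f0 v0)"
    unfolding Z_eq
    by (intro closed_Collect_eq continuous_on_const linear_continuous_on ell_bounded_linear)
  then have cl: "closed ?V"
    by (intro closed_Times) auto
  obtain C where C: "\<And>y. \<exists>x. ell (snd x) = 0 \<and> T x = y \<and> norm x \<le> C * norm y"
    using T_inverse by blast
  \<comment> \<open>By injectivity the preimage of \<open>T x\<close> that comes with a bound is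
    \<open>x\<close> itself.\<close>
  have bound: "norm x \<le> C * norm (T x)" if "x \<in> ?V" for x
  proof -
    obtain x' where x': "ell (snd x') = 0" "T x' = T x" "norm x' \<le> C * norm (T x)"
      using C by blast
    have "x - x' = 0"
      by (rule T_injective) (use that x' in \<open>simp_all add: Z linear_diff[OF lin] linear_diff[OF linear_T]\<close>)
    then show ?thesis using x'(3) by simp
  qed
  show ?thesis
  proof (rule implicit_function_continuous_parameter[where T = T and C = C])
    show "subspace ?V" "closed ?V" "linear T"
      by (fact sub cl linear_T)+
    show "norm x \<le> C * norm (T x)" if "x \<in> ?V" for x
      by (rule bound[OF that])
    show "(lam0, 0) \<in> ?V"
      by (simp add: Z linear_0[OF lin])
    show "\<exists>x\<in>?V. T x = y" for y
      using C[of y] Z by blast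
    show "G p N f f0 v0 0 (fst (lam0, 0)) (snd (lam0, 0)) = 0"
      by (simp add: G_eq H_0 S_p_h0)
    show "\<exists>\<delta>>0. \<forall>s x y. \<bar>s\<bar> < \<delta> \<longrightarrow> x \<in> ?V \<longrightarrow> y \<in> ?V \<longrightarrow> dist x (lam0, 0) < \<delta> \<longrightarrow> dist y (lam0, 0) < \<delta> \<longrightarrow>
        norm (G p N f f0 v0 s (fst x) (snd x) - G p N f f0 v0 s (fst y) (snd y) - T (x - y)) \<le> \<eta> * norm (x - y)"
      if "\<eta> > 0" for \<eta>
      using G_strict_derivative[OF that] by (elim exE conjE) blast
    show "\<exists>\<delta>>0. \<forall>x\<in>?V. dist x (lam0, 0) < \<delta> \<longrightarrow>
        continuous_on {-\<delta><..<\<delta>} (\<lambda>s. G p N f f0 v0 s (fst x) (snd x))"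
      using G_continuous by blast
  qed
qed

end

theorem lemma5:
  fixes N :: nat and p lam0 :: real
    and f :: "real \<Rightarrow> real \<Rightarrow> real" and f0 v0 :: C01
  assumes "N \<ge> 1" and "p > 2"
    and "continuous_on ({0..} \<times> UNIV) (\<lambda>(r, \<xi>). f r \<xi>)"
    and "\<forall>r\<in>{0..1}. f r 0 = 0"
    and "\<forall>r\<in>{0..1}. val f0 r > 0"
    and "H1 f"
    and "H4 p f f0" and "H4_left p f f0"
    and "lam0 > 0" and "positive_eigenfunction p N f0 lam0 v0"
    and "integral {0..1} (\<lambda>r. r ^ (N - 1) * val f0 r * \<bar>val v0 r\<bar> powr p) = 1"
  shows "\<exists>\<epsilon>>0. \<exists>U. openin (top_of_set (UNIV \<times> Z p N f0 v0)) U \<and> (lam0, 0) \<in> U \<and>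
    (\<exists>lam z. continuous_on {-\<epsilon><..<\<epsilon>} (\<lambda>s. (lam s, z s)) \<and>
      (\<forall>s\<in>{-\<epsilon><..<\<epsilon>}. (lam s, z s) \<in> U) \<and>
      (lam 0, z 0) = (lam0, 0) \<and>
      {(s, l, y). s \<in> {-\<epsilon><..<\<epsilon>} \<and> (l, y) \<in> U \<and> G p N f f0 v0 s l y = 0} =
      {(s, lam s, z s) |s. s \<in> {-\<epsilon><..<\<epsilon>}})"
proof -
  interpret bifurcation p f f0 N lam0 v0
    by unfold_locales (use assms in auto)
  let ?V = "UNIV \<times> Z p N f0 v0 :: (real \<times> C01) set"
  obtain \<epsilon> \<rho> x where \<epsilon>: "\<epsilon> > 0" "\<rho> > 0" and x: "continuous_on {-\<epsilon><..<\<epsilon>} x" "x 0 = (lam0, 0)"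
    and x_in: "\<And>s. s \<in> {-\<epsilon><..<\<epsilon>} \<Longrightarrow> x s \<in> ?V \<inter> ball (lam0, 0) \<rho>"
    and x_iff: "\<And>s y. s \<in> {-\<epsilon><..<\<epsilon>} \<Longrightarrow> y \<in> ?V \<inter> ball (lam0, 0) \<rho> \<Longrightarrow>
      G p N f f0 v0 s (fst y) (snd y) = 0 \<longleftrightarrow> y = x s"
    using bifurcation_curve by (elim exE conjE) blast
  \<comment> \<open>\<rho> does not depend on \<open>s\<close>, so one relatively open ball in the
    product with \<open>Z\<close> serves the whole parameter interval.\<close>
  let ?U = "?V \<inter> ball (lam0, 0) \<rho>"
  have "openin (top_of_set ?V) ?U"
    by (intro openin_open_Int open_ball)
  moreover have "(lam0, 0) \<in> ?U"
    using x_in[of 0] x(2) \<epsilon>(1) by simp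
  moreover have "{(s, l, y). s \<in> {-\<epsilon><..<\<epsilon>} \<and> (l, y) \<in> ?U \<and> G p N f f0 v0 s l y = 0} =
      {(s, fst (x s), snd (x s)) |s. s \<in> {-\<epsilon><..<\<epsilon>}}"
  proof (intro equalityI subsetI)
    fix a assume "a \<in> {(s, l, y). s \<in> {-\<epsilon><..<\<epsilon>} \<and> (l, y) \<in> ?U \<and> G p N f f0 v0 s l y = 0}"
    then obtain s l y where a: "a = (s, l, y)" "s \<in> {-\<epsilon><..<\<epsilon>}" "(l, y) \<in> ?U" "G p N f f0 v0 s l y = 0"
      by blast
    then have "(l, y) = x s"
      using x_iff[of s "(l, y)"] by simp
    then have "a = (s, fst (x s), snd (x s))"
      using a(1) by (simp flip: \<open>(l, y) = x s\<close>)
    with a(2) show "a \<in> {(s, fst (x s), snd (x s)) |s. s \<in> {-\<epsilon><..<\<epsilon>}}" by blast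
  next
    fix a assume "a \<in> {(s, fst (x s), snd (x s)) |s. s \<in> {-\<epsilon><..<\<epsilon>}}"
    then obtain s where "a = (s, fst (x s), snd (x s))" "s \<in> {-\<epsilon><..<\<epsilon>}" by blast
    then show "a \<in> {(s, l, y). s \<in> {-\<epsilon><..<\<epsilon>} \<and> (l, y) \<in> ?U \<and> G p N f f0 v0 s l y = 0}"
      using x_in[of s] x_iff[of s "x s"] by (simp add: mem_Times_iff case_prod_unfold)
  qed
  ultimately show ?thesis
    using \<epsilon>(1) x x_in
    by (intro exI[of _ \<epsilon>] conjI exI[of _ ?U] exI[of _ "\<lambda>s. fst (x s)"] exI[of _ "\<lambda>s. snd (x s)"])
      (simp_all only: prod.collapse, auto)
qed

end
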